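(* Suppose $\mathsf{SCH}^+$ holds, and $\square^{***}_{\omega_1,\mu}$ holds for every singular cardinal $\mu$ with $\mathrm{cf}(\mu) = \omega$. Then for any uncountable cardinal $\kappa$ and any completely metrizable space $X$ of weight $\kappa$: (i) If $\mathrm{cf}(\kappa) > \omega$, then $\mathfrak{cov}(X) = \mathfrak{par}(X) = \kappa$. (ii) If $\mathrm{cf}(\kappa) = \omega$, then either every closed subspace of $X$ is locally $<\!\kappa$-like, in which case $\mathfrak{cov}(X) = \mathfrak{par}(X) = \kappa$, or some closed subspace of $X$ is not locally $<\!\kappa$-like, in which case $\mathfrak{cov}(X) = \mathfrak{par}(X) = \kappa^+$. In particular, $\mathfrak{cov}(X) = \mathfrak{par}(X)$ for every completely metrizable space $X$.
   Context: A Polish space is a separable completely metrizable space. The weight $wt(X)$ of a topological space $X$ is the least cardinality of a basis for $X$. For a completely metrizable space $X$, $\mathfrak{cov}(X)$ denotes the smallest cardinality of a family of Polish subspaces of $X$ whose union is $X$, and $\mathfrak{par}(X)$ denotes the smallest cardinality of a partition of $X$ into Polish subspaces. A space $Y$ is locally $<\!\kappa$-like if for every nonempty open $U \subseteq Y$ there is a nonempty open $V \subseteq U$ with $wt(V) < \kappa$. For an infinite cardinal $\kappa$, $[\kappa]^{\aleph_0}$ is the set of countably infinite subsets of $\kappa$, and $\mathrm{cf}([\kappa]^{\aleph_0},\subseteq)$ is the least cardinality of a family $\mathcal{D} \subseteq [\kappa]^{\aleph_0}$ such that every member of $[\kappa]^{\aleph_0}$ is included in some member of $\mathcal{D}$.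 $\mathsf{SCH}^+$ is the statement: if $\kappa$ is a cardinal with uncountable cofinality, then $\mathrm{cf}([\kappa]^{\aleph_0},\subseteq) = \kappa$; and if $\kappa$ is a singular cardinal with $\mathrm{cf}(\kappa) = \omega$, then $\mathrm{cf}([\kappa]^{\aleph_0},\subseteq) = \kappa^+$. $\square^{***}_{\omega_1,\mu}$ (a weak square principle of Fuchino and Soukup) is the statement: there are a sequence $\langle C_\alpha : \alpha < \mu^+ \rangle$ and a closed unbounded set $D \subseteq \mu^+$ such that for every $\alpha \in D$ with $\mathrm{cf}(\alpha) \geq \omega_1$: (1) $C_\alpha \subseteq \alpha$ and $C_\alpha$ is unbounded in $\alpha$; and (2) for every countable $x \subseteq C_\alpha$ there is some $\alpha' < \alpha$ such that $C_{\alpha'}$ is a countable subset of $\alpha$ and $x \subseteq C_{\alpha'}$. *)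

theory Defs
  imports "HOL-Analysis.Analysis" "HOL-Library.Disjoint_Sets"
begin

unbundle cardinal_syntax

text \<open>
  Cardinals are the cardinal orders of \<^theory>\<open>HOL.BNF_Cardinal_Order_Relation\<close>: relations \<open>r\<close>
  with \<^prop>\<open>Card_order r\<close>, compared up to \<open>=o\<close>, \<open>\<le>o\<close>, \<open><o\<close>. Here \<^const>\<open>natLeq\<close> is \<open>\<omega>\<close>,
  \<^const>\<open>cardSuc\<close> is the cardinal successor, and the underlying set of \<open>r\<close> is \<^term>\<open>Field r\<close>.
  An element \<open>\<alpha>\<close> of the field of a well-order \<open>r\<close> stands for an ordinal below \<open>r\<close>;
  as a set it is \<^term>\<open>underS r \<alpha>\<close>.
\<close>

section \<open>Least cardinalities\<close>

definition least_card :: "'a set set \<Rightarrow> 'a rel" where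
  "least_card \<F> = card_of (SOME A. A \<in> \<F> \<and> (\<forall>B\<in>\<F>. |A| \<le>o |B| ))"

lemma least_card:
  assumes "\<F> \<noteq> {}"
  shows least_card_attained: "\<exists>A\<in>\<F>. least_card \<F> = |A|"
    and least_card_le: "\<And>B. B \<in> \<F> \<Longrightarrow> least_card \<F> \<le>o |B|"
proof -
  have "\<exists>r\<in>card_of ` \<F>. \<forall>r'\<in>card_of ` \<F>. r \<le>o r'"
    using assms by (intro exists_minim_Card_order) (auto simp: card_of_Card_order)
  then have *: "\<exists>A. A \<in> \<F> \<and> (\<forall>B\<in>\<F>. |A| \<le>o |B| )"
    by blast
  show "\<exists>A\<in>\<F>. least_card \<F> = |A|" "\<And>B. B \<in> \<F> \<Longrightarrow> least_card \<F> \<le>o |B|"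
    using someI_ex[OF *] unfolding least_card_def by blast+
qed

section \<open>Cofinality and the hypothesis SCH+\<close>

text \<open>
  Unboundedness is non-strict, unlike \<^const>\<open>cofinal\<close>, so that successor ordinals have
  cofinality 1.
\<close>
definition unbounded_in :: "'a rel \<Rightarrow> 'a set \<Rightarrow> bool" where
  "unbounded_in r A \<longleftrightarrow> A \<subseteq> Field r \<and> (\<forall>a\<in>Field r. \<exists>b\<in>A. (a, b) \<in> r)"

definition cf :: "'a rel \<Rightarrow> 'a rel" where
  "cf r = least_card {A. unbounded_in r A}"

definition singular_card :: "'a rel \<Rightarrow> bool" where
  "singular_card \<kappa> \<longleftrightarrow> Card_order \<kappa> \<and> infinite (Field \<kappa>) \<and> cf \<kappa> <o \<kappa>"

definition ctbl_infinite_subsets :: "'a rel \<Rightarrow> 'a set set" where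
  "ctbl_infinite_subsets \<kappa> = {x. x \<subseteq> Field \<kappa> \<and> countable x \<and> infinite x}"

definition cf_ctbl_subsets :: "'a rel \<Rightarrow> 'a set rel" where
  "cf_ctbl_subsets \<kappa> = least_card {\<D>. \<D> \<subseteq> ctbl_infinite_subsets \<kappa> \<and>
     (\<forall>x\<in>ctbl_infinite_subsets \<kappa>. \<exists>y\<in>\<D>. x \<subseteq> y)}"

text \<open>
  A formula of HOL cannot quantify over types, so SCH+ is relative to a type \<open>'a\<close>: it speaks
  about all cardinals that are represented on \<open>'a\<close>, i.e. all cardinals at most \<open>|UNIV :: 'a set|\<close>.
\<close>
definition SCH_plus :: "'a itself \<Rightarrow> bool" where
  "SCH_plus _ \<longleftrightarrow>
     (\<forall>\<kappa> :: 'a rel. Card_order \<kappa> \<and> natLeq <o cf \<kappa> \<longrightarrow> cf_ctbl_subsets \<kappa> =o \<kappa>) \<and>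
     (\<forall>\<kappa> :: 'a rel. singular_card \<kappa> \<and> cf \<kappa> =o natLeq \<longrightarrow> cf_ctbl_subsets \<kappa> =o cardSuc \<kappa>)"

section \<open>The weak square principle\<close>

definition seg :: "'a rel \<Rightarrow> 'a \<Rightarrow> 'a rel" where
  "seg r \<alpha> = Restr r (underS r \<alpha>)"

definition limit_ord :: "'a rel \<Rightarrow> 'a \<Rightarrow> bool" where
  "limit_ord r \<alpha> \<longleftrightarrow> underS r \<alpha> \<noteq> {} \<and>
     (\<forall>\<beta>\<in>underS r \<alpha>. \<exists>\<gamma>\<in>underS r \<alpha>. \<beta> \<in> underS r \<gamma>)"

definition club :: "'a rel \<Rightarrow> 'a set \<Rightarrow> bool" where
  "club r D \<longleftrightarrow> unbounded_in r D \<and>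
     (\<forall>\<alpha>\<in>Field r. limit_ord r \<alpha> \<and> unbounded_in (seg r \<alpha>) (D \<inter> underS r \<alpha>) \<longrightarrow> \<alpha> \<in> D)"

definition weak_square_omega1 :: "'a rel \<Rightarrow> bool" where
  "weak_square_omega1 \<mu> \<longleftrightarrow>
     (\<exists>(C :: 'a set \<Rightarrow> 'a set set) D. club (cardSuc \<mu>) D \<and>
       (\<forall>\<alpha>\<in>D. cardSuc natLeq \<le>o cf (seg (cardSuc \<mu>) \<alpha>) \<longrightarrow>
          C \<alpha> \<subseteq> underS (cardSuc \<mu>) \<alpha> \<and> unbounded_in (seg (cardSuc \<mu>) \<alpha>) (C \<alpha>) \<and>
          (\<forall>x. countable x \<and> x \<subseteq> C \<alpha> \<longrightarrow>
             (\<exists>\<alpha>'\<in>underS (cardSuc \<mu>) \<alpha>.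
                countable (C \<alpha>') \<and> C \<alpha>' \<subseteq> underS (cardSuc \<mu>) \<alpha> \<and> x \<subseteq> C \<alpha>'))))"

section \<open>Weight, coverings and partitions\<close>

definition wt :: "'a topology \<Rightarrow> 'a set rel" where
  "wt X = least_card {\<B>. openin X = arbitrary union_of (\<lambda>U. U \<in> \<B>)}"

definition Polish_space :: "'a topology \<Rightarrow> bool" where
  "Polish_space X \<longleftrightarrow> separable_space X \<and> completely_metrizable_space X"

definition Polish_subspaces :: "'a topology \<Rightarrow> 'a set set" where
  "Polish_subspaces X = {S. S \<subseteq> topspace X \<and> Polish_space (subtopology X S)}"

definition cov :: "'a topology \<Rightarrow> 'a set rel" where
  "cov X = least_card {\<F>. \<F> \<subseteq> Polish_subspaces X \<and> \<Union>\<F> = topspace X}"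

definition par :: "'a topology \<Rightarrow> 'a set rel" where
  "par X = least_card {\<F>. \<F> \<subseteq> Polish_subspaces X \<and> partition_on (topspace X) \<F>}"

definition locally_less_like :: "'k rel \<Rightarrow> 'a topology \<Rightarrow> bool" where
  "locally_less_like \<kappa> Y \<longleftrightarrow>
     (\<forall>U. openin Y U \<and> U \<noteq> {} \<longrightarrow>
        (\<exists>V. openin Y V \<and> V \<noteq> {} \<and> V \<subseteq> U \<and> wt (subtopology Y V) <o \<kappa>))"

text \<open>The families whose least cardinality is taken above are nonempty.\<close>

lemma unbounded_in_Field: "Well_order r \<Longrightarrow> unbounded_in r (Field r)"
  unfolding unbounded_in_def
  by (meson order_on_defs(1-3) refl_onD subset_refl well_order_on_def)

lemma base_exists: "{\<B>. openin X = arbitrary union_of (\<lambda>U. U \<in> \<B>)} \<noteq> {}"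
proof -
  have "openin X = arbitrary union_of (\<lambda>U. U \<in> Collect (openin X))"
    unfolding openin_topology_base_unique by blast
  then have "Collect (openin X) \<in> {\<B>. openin X = arbitrary union_of (\<lambda>U. U \<in> \<B>)}"
    by (rule CollectI)
  then show ?thesis by (metis empty_iff)
qed

lemma ctbl_infinite_subsets_cofinal_exists:
  "{\<D>. \<D> \<subseteq> ctbl_infinite_subsets \<kappa> \<and> (\<forall>x\<in>ctbl_infinite_subsets \<kappa>. \<exists>y\<in>\<D>. x \<subseteq> y)} \<noteq> {}"
proof -
  have "ctbl_infinite_subsets \<kappa> \<in> {\<D>. \<D> \<subseteq> ctbl_infinite_subsets \<kappa> \<and>
      (\<forall>x\<in>ctbl_infinite_subsets \<kappa>. \<exists>y\<in>\<D>. x \<subseteq> y)}"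
    by auto
  then show ?thesis by (metis empty_iff)
qed

lemma singleton_Polish:
  assumes "completely_metrizable_space X" "x \<in> topspace X"
  shows "{x} \<in> Polish_subspaces X"
proof -
  have "closedin X {x}"
    using assms by (meson completely_metrizable_imp_metrizable_space metrizable_imp_t1_space
        t1_space_closedin_singleton)
  then have "completely_metrizable_space (subtopology X {x})"
    using assms(1) completely_metrizable_space_closedin by blast
  moreover have "separable_space (subtopology X {x})"
  proof -
    have top: "topspace (subtopology X {x}) = {x}"
      using assms(2) by auto
    have "subtopology X {x} closure_of {x} = {x}"
      using closure_of_topspace[of "subtopology X {x}"] unfolding top .
    then show ?thesis
      unfolding separable_space_def top by (intro exI[of _ "{x}"]) simp
  qed
  ultimately show ?thesis
    using assms(2) by (simp add: Polish_subspaces_def Polish_space_def)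
qed

lemma Polish_partition_exists:
  assumes "completely_metrizable_space X"
  shows "{\<F>. \<F> \<subseteq> Polish_subspaces X \<and> partition_on (topspace X) \<F>} \<noteq> {}"
proof -
  have "partition_on (topspace X) ((\<lambda>x. {x}) ` topspace X)"
    by (auto simp: partition_on_def disjoint_def)
  moreover have "(\<lambda>x. {x}) ` topspace X \<subseteq> Polish_subspaces X"
    using singleton_Polish[OF assms] by (rule image_subsetI)
  ultimately have "(\<lambda>x. {x}) ` topspace X \<in>
      {\<F>. \<F> \<subseteq> Polish_subspaces X \<and> partition_on (topspace X) \<F>}"
    by simp
  then show ?thesis by (metis empty_iff)
qed

end

theory Submission
  imports Defs
begin

text \<open>
  Upper bounds. Fix a dense set \<open>D\<close> of size \<open>\<kappa>\<close>. If \<open>X\<close> is the union of an increasing well-ordered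
  family of sets, each a countable union of closures of sets of size less than \<open>\<kappa>\<close>, and the union of
  every initial part of the family is \<open>F\<^sub>\<sigma>\<close>, then the successive differences are completely metrizable
  pieces that can be partitioned by induction on \<open>\<kappa>\<close>. If \<open>cf \<kappa> > \<omega>\<close>, the closures of the initial
  segments of \<open>D\<close> form such a family of length \<open>\<kappa>\<close>. If \<open>cf \<kappa> = \<omega>\<close>, SCH+ gives countable sets
  \<open>d \<xi>\<close>, \<open>\<xi> < \<kappa>\<^sup>+\<close>, cofinal among the countable subsets of \<open>D\<close>, and the weak square principle makes
  \<open>\<Union>\<xi><\<alpha>. cl (d \<xi>)\<close> a countable union of closures of small sets for unboundedly many \<open>\<alpha>\<close> (a dominating
  matrix in the sense of Fuchino and Soukup). If every closed subspace is locally \<open><\<kappa>\<close>-like, one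
  instead exhausts \<open>X\<close> by open sets that can be partitioned into \<open>\<kappa>\<close> Polish subspaces.

  Lower bounds. A union of fewer than \<open>\<kappa>\<close> Polish subspaces has weight less than \<open>\<kappa>\<close>; and if
  \<open>cf \<kappa> = \<omega>\<close>, a union of \<open>\<kappa>\<close> Polish subspaces is contained in a union of countably many closed sets
  of weight less than \<open>\<kappa>\<close>, to which Baire's theorem applies.
\<close>

section \<open>Well-orders and cofinality\<close>

lemma underS_trans:
  assumes "Well_order r" "a \<in> underS r b" "b \<in> underS r c"
  shows "a \<in> underS r c"
  using assms unfolding underS_def order_on_defs
  by (auto dest: transD antisymD)

lemma underS_linear:
  assumes "Well_order r" "a \<in> Field r" "b \<in> Field r"
  shows "a = b \<or> a \<in> underS r b \<or> b \<in> underS r a"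
  using assms unfolding underS_def order_on_defs total_on_def by blast

lemma underS_asym: "Well_order r \<Longrightarrow> a \<in> underS r b \<Longrightarrow> b \<notin> underS r a"
  by (metis underS_notIn underS_trans)

lemma rel_iff_underS:
  assumes "Well_order r"
  shows "(a, b) \<in> r \<longleftrightarrow> b \<in> Field r \<and> (a = b \<or> a \<in> underS r b)"
  using assms unfolding underS_def order_on_defs
  by (auto dest: refl_onD simp: FieldI2)

lemma Well_order_minimal:
  assumes "Well_order r" "A \<subseteq> Field r" "A \<noteq> {}"
  shows "\<exists>a\<in>A. \<forall>b\<in>A. b \<notin> underS r a"
proof -
  have "wf (r - Id)"
    using assms by (simp add: well_order_on_def)
  then obtain a where "a \<in> A" "\<And>b. (b, a) \<in> r - Id \<Longrightarrow> b \<notin> A"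
    using assms(3) by (metis wfE_min ex_in_conv)
  then show ?thesis
    by (auto simp: underS_def)
qed

text \<open>The order is total, so "some element of \<open>A\<close> is at or above
  \<open>a\<close>" negates "all elements of \<open>A\<close> lie strictly below \<open>a\<close>".
  Most later arguments use this form.\<close>

lemma unbounded_in_iff:
  assumes "Well_order r"
  shows "unbounded_in r A \<longleftrightarrow> A \<subseteq> Field r \<and> \<not> (\<exists>a\<in>Field r. A \<subseteq> underS r a)"
proof -
  have "(a, b) \<in> r \<longleftrightarrow> b \<notin> underS r a" if "a \<in> Field r" "b \<in> Field r" for a b
    using that underS_linear[OF assms, of a b] underS_asym[OF assms, of a b] underS_notIn[of a r]
    unfolding rel_iff_underS[OF assms] by blast
  then show ?thesis
    unfolding unbounded_in_def by blast
qed

lemma Well_order_seg: "Well_order r \<Longrightarrow> Well_order (seg r \<alpha>)"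
  unfolding seg_def by (rule Well_order_Restr)

lemma Field_seg: "Well_order r \<Longrightarrow> Field (seg r \<alpha>) = underS r \<alpha>"
  unfolding seg_def
  by (rule Refl_Field_Restr2) (auto simp: order_on_defs underS_def Field_def)

lemma underS_seg: "Well_order r \<Longrightarrow> b \<in> underS r \<alpha> \<Longrightarrow> underS (seg r \<alpha>) b = underS r b"
  using underS_trans[of r _ b \<alpha>] unfolding seg_def by (auto simp: underS_def)

lemma unbounded_in_seg_iff:
  assumes "Well_order r"
  shows "unbounded_in (seg r \<alpha>) A \<longleftrightarrow>
    A \<subseteq> underS r \<alpha> \<and> \<not> (\<exists>b\<in>underS r \<alpha>. A \<subseteq> underS r b)"
  unfolding unbounded_in_iff[OF Well_order_seg[OF assms]] Field_seg[OF assms]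
  using underS_seg[OF assms] by blast

section \<open>Cofinality of well-orders and cardinals\<close>

lemma countable_iff_ordLeq_natLeq: "countable A \<longleftrightarrow> |A| \<le>o natLeq"
proof -
  have "countable A \<longleftrightarrow> |A| \<le>o |UNIV :: nat set|"
    unfolding countable_def card_of_ordLeq[symmetric] by simp
  then show ?thesis
    using card_of_nat ordLeq_ordIso_trans ordIso_symmetric by blast
qed

lemma uncountable_iff_natLeq_ordLess: "uncountable A \<longleftrightarrow> natLeq <o |A|"
  using not_ordLeq_iff_ordLess[OF natLeq_Well_order card_of_Well_order]
  unfolding countable_iff_ordLeq_natLeq by blast

lemma Card_order_least_card: "Card_order (least_card F)"
  unfolding least_card_def by (rule card_of_Card_order)

lemma cf_attained:
  assumes "Well_order r"
  shows "\<exists>A. unbounded_in r A \<and> cf r = |A|"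
proof -
  have "{A. unbounded_in r A} \<noteq> {}"
    using unbounded_in_Field[OF assms] by blast
  from least_card_attained[OF this] show ?thesis
    unfolding cf_def by blast
qed

lemma cf_le:
  assumes "Well_order r" "unbounded_in r A"
  shows "cf r \<le>o |A|"
  unfolding cf_def by (rule least_card_le) (use assms in auto)

lemma Card_order_cf: "Card_order (cf r)"
  unfolding cf_def by (rule Card_order_least_card)

text \<open>On \<open>Field r\<close> or a segment this is uncountable cofinality; being stated for
  any index set, it also applies to sets such as \<open>T \<inter> underS r \<alpha>\<close> that
  are not segments. The instances \<open>c = {}\<close> and \<open>c = {\<gamma>}\<close> show that
  \<open>I\<close> is nonempty and has no largest element.\<close>

definition uncountably_cofinal :: "'a rel \<Rightarrow> 'a set \<Rightarrow> bool" where
  "uncountably_cofinal r I \<longleftrightarrow> (\<forall>c. countable c \<and> c \<subseteq> I \<longrightarrow> (\<exists>a\<in>I. c \<subseteq> underS r a))"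

lemma uncountably_cofinalD:
  "uncountably_cofinal r I \<Longrightarrow> countable c \<Longrightarrow> c \<subseteq> I \<Longrightarrow> \<exists>a\<in>I. c \<subseteq> underS r a"
  by (simp add: uncountably_cofinal_def)

lemma natLeq_ordLess_cf_iff:
  assumes "Well_order r"
  shows "natLeq <o cf r \<longleftrightarrow> uncountably_cofinal r (Field r)"
proof
  assume *: "natLeq <o cf r"
  show "uncountably_cofinal r (Field r)"
    unfolding uncountably_cofinal_def
  proof (intro allI impI; elim conjE)
    fix c assume c: "countable c" "c \<subseteq> Field r"
    show "\<exists>a\<in>Field r. c \<subseteq> underS r a"
    proof (rule ccontr)
      assume "\<not> ?thesis"
      then have "cf r \<le>o |c|"
        using assms c by (intro cf_le) (auto simp: unbounded_in_iff)
      also have "|c| \<le>o natLeq"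
        using c countable_iff_ordLeq_natLeq by blast
      finally show False
        using * not_ordLess_ordLeq by blast
    qed
  qed
next
  assume *: "uncountably_cofinal r (Field r)"
  obtain A where A: "unbounded_in r A" "cf r = |A|"
    using cf_attained[OF assms] by blast
  then have "uncountable A"
    using * assms by (auto simp: unbounded_in_iff uncountably_cofinal_def)
  then show "natLeq <o cf r"
    using A uncountable_iff_natLeq_ordLess by metis
qed

text \<open>Translates the proviso on cofinality in the weak square principle; below a point of
  \<open>underS r \<alpha>\<close>, the orders \<open>seg r \<alpha>\<close> and \<open>r\<close>
  have the same segments.\<close>

lemma cardSuc_natLeq_ordLeq_cf_seg_iff:
  assumes "Well_order r"
  shows "cardSuc natLeq \<le>o cf (seg r \<alpha>) \<longleftrightarrow> uncountably_cofinal r (underS r \<alpha>)"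
proof -
  have "cardSuc natLeq \<le>o cf (seg r \<alpha>) \<longleftrightarrow> uncountably_cofinal (seg r \<alpha>) (underS r \<alpha>)"
    using natLeq_ordLess_cf_iff[OF Well_order_seg[OF assms]]
    by (simp add: cardSuc_ordLess_ordLeq[symmetric] natLeq_Card_order Card_order_cf Field_seg assms)
  also have "\<dots> \<longleftrightarrow> uncountably_cofinal r (underS r \<alpha>)"
    unfolding uncountably_cofinal_def using underS_seg[OF assms] by metis
  finally show ?thesis .
qed

text \<open>An infinite cardinal has no largest element, so finite sets get strict upper bounds by
  induction, and no finite set is unbounded.\<close>

lemma natLeq_ordLeq_cf:
  assumes "Card_order r" "infinite (Field r)"
  shows "natLeq \<le>o cf r"
proof -
  have wo: "Well_order r"
    using assms(1) by (rule card_order_on_well_order_on)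
  obtain A where A: "unbounded_in r A" "cf r = |A|"
    using cf_attained[OF wo] by blast
  have "\<exists>a\<in>Field r. F \<subseteq> underS r a" if "finite F" "F \<subseteq> Field r" for F
    using that
  proof (induction F)
    case empty
    then show ?case
      using assms(2) by (metis empty_subsetI ex_in_conv finite.emptyI)
  next
    case (insert x F)
    then obtain a where a: "a \<in> Field r" "F \<subseteq> underS r a"
      by blast
    \<comment> \<open>\<open>m\<close> is the larger of the old bound \<open>a\<close> and the new
      element \<open>x\<close>; a point strictly above \<open>m\<close> bounds the whole
      set.\<close>
    define m where "m = (if x \<in> underS r a then a else x)"
    have "m \<in> Field r"
      using a insert by (simp add: m_def)
    then obtain b where b: "b \<in> Field r" "m \<in> underS r b"
      using infinite_Card_order_limit[OF assms] by (fastforce simp: underS_def)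
    have "insert x F \<subseteq> underS r b"
    proof
      fix y assume y: "y \<in> insert x F"
      then have "y = m \<or> y \<in> underS r m"
        using a insert.prems underS_trans[OF wo, of y a x] underS_linear[OF wo, of a x]
        unfolding m_def by fastforce
      then show "y \<in> underS r b"
        using b(2) underS_trans[OF wo] by blast
    qed
    then show ?case
      using b by blast
  qed
  then have "infinite A"
    using A(1) by (auto simp: unbounded_in_iff[OF wo])
  then show ?thesis
    unfolding A(2) using infinite_iff_natLeq_ordLeq by blast
qed

lemma cf_cases:
  assumes "Card_order r" "infinite (Field r)"
  obtains "natLeq <o cf r" | "cf r =o natLeq"
  using natLeq_ordLeq_cf[OF assms] ordLeq_iff_ordLess_or_ordIso ordIso_symmetric by blast

lemma cf_mono_iso:
  fixes r :: "'a rel" and r' :: "'b rel"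
  assumes "r =o r'"
  shows "cf r' \<le>o cf r"
proof -
  have wo: "Well_order r" "Well_order r'"
    using assms by (auto simp: ordIso_def)
  obtain f where "iso r r' f"
    using assms by (auto simp: ordIso_def)
  then have f: "bij_betw f (Field r) (Field r')"
    "\<And>a b. a \<in> Field r \<Longrightarrow> b \<in> Field r \<Longrightarrow> (a, b) \<in> r \<longleftrightarrow> (f a, f b) \<in> r'"
    by (auto simp: iso_iff2)
  obtain A where A: "unbounded_in r A" "cf r = |A|"
    using cf_attained[OF wo(1)] by blast
  have "unbounded_in r' (f ` A)"
    unfolding unbounded_in_def
  proof (intro conjI ballI)
    show "f ` A \<subseteq> Field r'"
      using f(1) A(1) by (auto simp: unbounded_in_def bij_betw_def)
    fix a' assume "a' \<in> Field r'"
    then obtain a where a: "a \<in> Field r" "a' = f a"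
      using f(1) by (auto simp: bij_betw_def)
    then obtain b where "b \<in> A" "(a, b) \<in> r"
      using A(1) by (auto simp: unbounded_in_def)
    then show "\<exists>b\<in>f ` A. (a', b) \<in> r'"
      using f(2) a by (metis FieldI2 imageI)
  qed
  then have "cf r' \<le>o |f ` A|"
    using wo by (intro cf_le)
  also have "|f ` A| \<le>o |A|"
    by (rule card_of_image)
  finally show ?thesis
    by (simp add: A(2))
qed

lemma cf_cong: "(r :: 'a rel) =o (r' :: 'b rel) \<Longrightarrow> cf r =o cf r'"
  by (simp add: cf_mono_iso ordIso_iff_ordLeq ordIso_symmetric)

text \<open>The pieces are the initial segments given by a countable unbounded set; proper segments
  of a cardinal are smaller than it.\<close>

lemma countable_cofinality_decomposition:
  assumes "infinite D" "cf |D| =o natLeq"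
  obtains A :: "nat \<Rightarrow> 'a set" where "(\<Union>n. A n) = D" "\<And>n. |A n| <o |D|"
proof -
  have wo: "Well_order |D|"
    by (rule card_of_Well_order)
  obtain c where c: "unbounded_in |D| c" "cf |D| = |c|"
    using cf_attained[OF wo] by blast
  then have "countable c"
    using assms(2) countable_iff_ordLeq_natLeq[of c] ordIso_iff_ordLeq by metis
  moreover have "c \<noteq> {}"
    using assms c(1) by (auto simp: unbounded_in_def Field_card_of)
  ultimately obtain s :: "nat \<Rightarrow> 'a" where s: "range s = c"
    by (metis range_from_nat_into)
  \<comment> \<open>The point \<open>s n\<close> itself is inserted because unboundedness is
    non-strict.\<close>
  define A where "A n = insert (s n) (underS |D| (s n))" for n
  have "(\<Union>n. A n) = D"
  proof
    show "(\<Union>n. A n) \<subseteq> D"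
      using c(1) s underS_Field[of _ "|D|"] by (auto simp: A_def unbounded_in_def Field_card_of)
    show "D \<subseteq> (\<Union>n. A n)"
      using c(1) s by (force simp: A_def unbounded_in_def Field_card_of rel_iff_underS[OF wo])
  qed
  moreover have "|A n| <o |D|" for n
  proof -
    have "s n \<in> D"
      using c(1) s by (auto simp: unbounded_in_def Field_card_of)
    then have "|underS |D| (s n)| <o |D|"
      by (metis card_of_underS card_of_Card_order Field_card_of)
    moreover have "|{s n}| <o |D|"
      using assms(1) by (intro finite_ordLess_infinite) (auto simp: card_of_well_order_on Field_card_of)
    ultimately have "|{s n} \<union> underS |D| (s n)| <o |D|"
      using assms(1) by (intro card_of_Un_ordLess_infinite)
    then show ?thesis
      by (simp add: A_def)
  qed
  ultimately show thesis
    by (rule that)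
qed

text \<open>The union has at most max(|I|, \<omega>) elements, so the bound holds for singular
  \<open>|B|\<close> as well. With finite \<open>I\<close> the union may still be infinite, and
  there the uncountability of \<open>B\<close> decides.\<close>

lemma card_of_UN_countable_ordLess:
  assumes "natLeq <o |B|" "|I| <o |B|" "\<And>i. i \<in> I \<Longrightarrow> countable (S i)"
  shows "|\<Union>i\<in>I. S i| <o |B|"
proof (cases "finite I")
  case True
  then have "countable (\<Union>i\<in>I. S i)"
    using assms(3) by (auto simp: countable_finite)
  then show ?thesis
    using assms(1) countable_iff_ordLeq_natLeq ordLeq_ordLess_trans by blast
next
  case False
  have "|S i| \<le>o |I|" if "i \<in> I" for i
    using assms(3)[OF that] False countable_iff_ordLeq_natLeq infinite_iff_natLeq_ordLeq
      ordLeq_transitive by blast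
  then have "|\<Union>i\<in>I. S i| \<le>o |I|"
    using False by (intro card_of_UNION_ordLeq_infinite) (auto simp: card_of_refl ordIso_imp_ordLeq)
  then show ?thesis
    using assms(2) ordLeq_ordLess_trans by blast
qed

lemma Cinfinite_card_of: "infinite D \<Longrightarrow> Cinfinite |D|"
  by (metis card_of_Card_order cinfinite_def Field_card_of)

section \<open>Cofinal families of countable sets under SCH+\<close>

lemma ctbl_infinite_superset:
  assumes "infinite D" "countable x" "x \<subseteq> D"
  shows "\<exists>y \<in> ctbl_infinite_subsets |D|. x \<subseteq> y"
proof -
  obtain z where "z \<subseteq> D" "countable z" "infinite z"
    using infinite_countable_subset'[OF assms(1)] by blast
  then show ?thesis
    using assms by (intro bexI[of _ "x \<union> z"]) (auto simp: ctbl_infinite_subsets_def Field_card_of)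
qed

lemma cf_ctbl_subsets_attained:
  "\<exists>\<D>\<subseteq>ctbl_infinite_subsets \<kappa>. (\<forall>x\<in>ctbl_infinite_subsets \<kappa>. \<exists>y\<in>\<D>. x \<subseteq> y) \<and>
    cf_ctbl_subsets \<kappa> = |\<D>|"
proof -
  let ?F = "{\<D>. \<D> \<subseteq> ctbl_infinite_subsets \<kappa> \<and>
    (\<forall>x\<in>ctbl_infinite_subsets \<kappa>. \<exists>y\<in>\<D>. x \<subseteq> y)}"
  have "\<exists>\<D>\<in>?F. cf_ctbl_subsets \<kappa> = |\<D>|"
    unfolding cf_ctbl_subsets_def
    by (rule least_card_attained[OF ctbl_infinite_subsets_cofinal_exists[of \<kappa>]])
  then show ?thesis
    unfolding Bex_def mem_Collect_eq conj_assoc .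
qed

text \<open>The two clauses of SCH+ give a family of size \<open>|D|\<close> or
  \<open>cardSuc |D|\<close>, according to the cofinality. It serves for finite subsets too, since
  every countable subset of \<open>D\<close> extends to an infinite countable one.\<close>

lemma SCH_plus_cofinal_family:
  fixes D :: "'a set"
  assumes "SCH_plus TYPE('a)" "infinite D"
  obtains \<D> where "|\<D>| \<le>o cardSuc |D|" "\<And>y. y \<in> \<D> \<Longrightarrow> countable y \<and> y \<subseteq> D"
    "\<And>x. countable x \<Longrightarrow> x \<subseteq> D \<Longrightarrow> \<exists>y\<in>\<D>. x \<subseteq> y"
proof (cases "countable D")
  case True
  \<comment> \<open>A countable \<open>D\<close> has countable cofinality without being singular, so
    neither clause of SCH+ covers it; the family \<open>{D}\<close> is cofinal.\<close>
  have "|{D}| \<le>o |D|"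
    using assms(2) by (intro card_of_singl_ordLeq) auto
  then have "|{D}| \<le>o cardSuc |D|"
    using cardSuc_ordLeq[OF card_of_Card_order] ordLeq_transitive by blast
  then show thesis
    using True that[of "{D}"] by (metis order_refl singletonD singletonI)
next
  case False
  have card: "Card_order |D|" "infinite (Field |D| )"
    using assms(2) card_of_Card_order[of D] Field_card_of[of D] by metis+
  have "cf_ctbl_subsets |D| \<le>o cardSuc |D|"
  proof (cases rule: cf_cases[OF card])
    case 1
    then have "cf_ctbl_subsets |D| =o |D|"
      using assms(1) card(1) unfolding SCH_plus_def by blast
    then show ?thesis
      using cardSuc_ordLeq[OF card(1)] ordIso_ordLeq_trans by blast
  next
    case 2
    moreover from 2 have "singular_card |D|"
      unfolding singular_card_def
      using card False ordIso_ordLess_trans uncountable_iff_natLeq_ordLess by blast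
    ultimately have "cf_ctbl_subsets |D| =o cardSuc |D|"
      using assms(1) unfolding SCH_plus_def by blast
    then show ?thesis
      by (rule ordIso_imp_ordLeq)
  qed
  moreover obtain \<D> where \<D>: "\<D> \<subseteq> ctbl_infinite_subsets |D|"
    "\<And>x. x \<in> ctbl_infinite_subsets |D| \<Longrightarrow> \<exists>y\<in>\<D>. x \<subseteq> y" "cf_ctbl_subsets |D| = |\<D>|"
    using cf_ctbl_subsets_attained[of "|D|"] by (elim exE conjE) (rule that, auto)
  ultimately have "|\<D>| \<le>o cardSuc |D|"
    by metis
  moreover have "countable y \<and> y \<subseteq> D" if "y \<in> \<D>" for y
    using \<D>(1) that by (auto simp: ctbl_infinite_subsets_def Field_card_of)
  moreover have "\<exists>y\<in>\<D>. x \<subseteq> y" if "countable x" "x \<subseteq> D" for x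
    using ctbl_infinite_superset[OF assms(2) that] \<D>(2) by (meson order_trans)
  ultimately show thesis
    by (rule that)
qed

section \<open>Weight and density\<close>

lemma wt_attained:
  "\<exists>\<B>. openin X = arbitrary union_of (\<lambda>U. U \<in> \<B>) \<and> wt X = |\<B>|"
  using least_card_attained[OF base_exists[of X]] unfolding wt_def by blast

lemma wt_le: "openin X = arbitrary union_of (\<lambda>U. U \<in> \<B>) \<Longrightarrow> wt X \<le>o |\<B>|"
  unfolding wt_def by (rule least_card_le[OF base_exists]) (rule CollectI)

lemma Card_order_wt: "Card_order (wt X)"
  unfolding wt_def by (rule Card_order_least_card)

lemma metrizable_base_of_dense:
  assumes "metrizable_space X" "D \<subseteq> topspace X" "X closure_of D = topspace X"
  obtains \<B> where "openin X = arbitrary union_of (\<lambda>U. U \<in> \<B>)"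
    "|\<B>| \<le>o |D \<times> (UNIV :: nat set)|"
proof -
  obtain M d where "Metric_space M d" and Xeq: "X = Metric_space.mtopology M d"
    using assms(1) unfolding metrizable_space_def by blast
  then interpret Metric_space M d
    by blast
  define \<B> where "\<B> = (\<lambda>(x, n). mball x (inverse (real (Suc n)))) ` (D \<times> (UNIV :: nat set))"
  have "openin X = arbitrary union_of (\<lambda>U. U \<in> \<B>)"
    unfolding openin_topology_base_unique
  proof (intro conjI allI impI)
    show "openin X V" if "V \<in> \<B>" for V
      using that by (auto simp: \<B>_def Xeq)
    fix U x assume "openin X U \<and> x \<in> U"
    then have "U \<subseteq> M" "\<exists>r>0. mball x r \<subseteq> U" "x \<in> U"
      unfolding Xeq openin_mtopology by simp_all
    then obtain r where x: "x \<in> M" and r: "r > 0" "mball x r \<subseteq> U"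
      by (meson subsetD)
    \<comment> \<open>With a radius below \<open>r / 2\<close>, a point \<open>y\<close> of
      \<open>D\<close> that close to \<open>x\<close> has \<open>x\<close> in its ball, and this
      ball stays inside \<open>mball x r\<close>.\<close>
    obtain n :: nat where n: "inverse (real (Suc n)) < r / 2"
      using reals_Archimedean[of "r / 2"] r by auto
    have "x \<in> X closure_of D"
      using assms(3) x by (simp add: Xeq)
    then have "\<forall>r>0. \<exists>y\<in>D. y \<in> mball x r"
      unfolding Xeq metric_closure_of by simp
    moreover have "inverse (real (Suc n)) > 0"
      by simp
    ultimately obtain y where y: "y \<in> D" "y \<in> mball x (inverse (real (Suc n)))"
      by meson
    have "mball y (inverse (real (Suc n))) \<subseteq> mball x r"
    proof
      fix z assume z: "z \<in> mball y (inverse (real (Suc n)))"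
      then have "d x z \<le> d x y + d y z"
        using x y by (intro triangle) auto
      then show "z \<in> mball x r"
        using y z n x by auto
    qed
    moreover have "x \<in> mball y (inverse (real (Suc n)))"
      using x y by (simp add: commute)
    moreover have "mball y (inverse (real (Suc n))) \<in> \<B>"
      using y(1) unfolding \<B>_def by (intro image_eqI[of _ _ "(y, n)"]) auto
    ultimately show "\<exists>V. V \<in> \<B> \<and> x \<in> V \<and> V \<subseteq> U"
      using r(2) by (meson order_trans)
  qed
  moreover have "|\<B>| \<le>o |D \<times> (UNIV :: nat set)|"
    unfolding \<B>_def by (rule card_of_image)
  ultimately show thesis
    by (rule that)
qed

lemma wt_le_dense:
  assumes "metrizable_space X" "D \<subseteq> topspace X" "X closure_of D = topspace X"
  shows "wt X \<le>o |D \<times> (UNIV :: nat set)|"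
  using metrizable_base_of_dense[OF assms] wt_le ordLeq_transitive by metis

lemma card_of_Times_nat: "infinite D \<Longrightarrow> |D \<times> (UNIV :: nat set)| \<le>o |D|"
  using card_of_Times_infinite_simps(1)[of D "UNIV :: nat set"]
  by (meson UNIV_not_empty infinite_iff_card_of_nat ordIso_imp_ordLeq)

text \<open>For infinite \<open>D\<close> the factor \<omega> of the base of balls is absorbed; a
  finite \<open>D\<close> still gives a countable base, which is below the uncountable
  \<open>\<kappa>\<close>.\<close>

lemma wt_less_dense:
  assumes "metrizable_space X" "D \<subseteq> topspace X" "X closure_of D = topspace X"
    and "natLeq <o \<kappa>" "|D| <o \<kappa>"
  shows "wt X <o \<kappa>"
proof (cases "finite D")
  case True
  then have "|D \<times> (UNIV :: nat set)| \<le>o natLeq"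
    by (simp add: countable_iff_ordLeq_natLeq[symmetric] countable_finite)
  then show ?thesis
    using wt_le_dense[OF assms(1-3)] assms(4) ordLeq_transitive ordLeq_ordLess_trans by blast
next
  case False
  then show ?thesis
    using wt_le_dense[OF assms(1-3)] card_of_Times_nat assms(5)
      ordLeq_transitive ordLeq_ordLess_trans by blast
qed

lemma dense_of_base:
  assumes "openin X = arbitrary union_of (\<lambda>U. U \<in> \<B>)"
  obtains D where "D \<subseteq> topspace X" "X closure_of D = topspace X" "|D| \<le>o |\<B>|"
proof -
  have base: "\<And>V. V \<in> \<B> \<Longrightarrow> openin X V"
    "\<And>U x. openin X U \<Longrightarrow> x \<in> U \<Longrightarrow> \<exists>V\<in>\<B>. x \<in> V \<and> V \<subseteq> U"
    using assms unfolding openin_topology_base_unique by blast+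
  define D where "D = (\<lambda>V. SOME x. x \<in> V) ` {V \<in> \<B>. V \<noteq> {}}"
  have some: "(SOME x. x \<in> V) \<in> V" if "V \<noteq> {}" for V :: "'a set"
    using that by (simp add: some_in_eq)
  have "|D| \<le>o |{V \<in> \<B>. V \<noteq> {}}|"
    unfolding D_def by (rule card_of_image)
  also have "|{V \<in> \<B>. V \<noteq> {}}| \<le>o |\<B>|"
    by (rule card_of_mono1) auto
  finally have "|D| \<le>o |\<B>|" .
  moreover have "D \<subseteq> topspace X"
    using base(1) some openin_subset unfolding D_def by blast
  moreover have "x \<in> X closure_of D" if "x \<in> topspace X" for x
    unfolding in_closure_of
  proof (intro conjI allI impI that; elim conjE)
    fix T assume "x \<in> T" "openin X T"
    then obtain V where V: "V \<in> \<B>" "x \<in> V" "V \<subseteq> T"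
      using base(2) by blast
    then have "V \<noteq> {}"
      by blast
    then show "\<exists>y. y \<in> D \<and> y \<in> T"
      using V some[of V] by (auto simp: D_def)
  qed
  ultimately show thesis
    using closure_of_subset_topspace[of X D] by (intro that) auto
qed

lemma dense_of_wt:
  obtains D where "D \<subseteq> topspace X" "X closure_of D = topspace X" "|D| \<le>o wt X"
  using wt_attained[of X] dense_of_base by metis

lemma wt_subtopology_le: "wt (subtopology X S) \<le>o wt X"
proof -
  obtain \<B> where \<B>: "openin X = arbitrary union_of (\<lambda>U. U \<in> \<B>)" "wt X = |\<B>|"
    using wt_attained by blast
  have "openin (subtopology X S) = arbitrary union_of (\<lambda>U. U \<in> (\<inter>) S ` \<B>)"
    unfolding openin_topology_base_unique
  proof (intro conjI allI impI)
    show "openin (subtopology X S) V" if "V \<in> (\<inter>) S ` \<B>" for V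
      using \<B>(1) that unfolding openin_topology_base_unique
      by (auto simp: openin_subtopology_Int2)
    fix U x assume "openin (subtopology X S) U \<and> x \<in> U"
    then obtain W where "openin X W" "U = W \<inter> S" "x \<in> U"
      unfolding openin_subtopology by blast
    then show "\<exists>V. V \<in> (\<inter>) S ` \<B> \<and> x \<in> V \<and> V \<subseteq> U"
      using \<B>(1) unfolding openin_topology_base_unique by (metis Int_iff Int_commute Int_mono image_eqI order_refl)
  qed
  then have "wt (subtopology X S) \<le>o |(\<inter>) S ` \<B>|"
    by (rule wt_le)
  also have "|(\<inter>) S ` \<B>| \<le>o |\<B>|"
    by (rule card_of_image)
  finally show ?thesis
    by (simp add: \<B>(2))
qed

lemma separable_metrizable_imp_second_countable:
  assumes "metrizable_space X" "separable_space X"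
  shows "second_countable X"
proof -
  obtain D where D: "countable D" "D \<subseteq> topspace X" "X closure_of D = topspace X"
    using assms(2) unfolding separable_space_def by blast
  obtain \<B> where \<B>: "openin X = arbitrary union_of (\<lambda>U. U \<in> \<B>)"
    "|\<B>| \<le>o |D \<times> (UNIV :: nat set)|"
    using metrizable_base_of_dense[OF assms(1) D(2,3)] by blast
  have "|D \<times> (UNIV :: nat set)| \<le>o natLeq"
    using D(1) by (simp add: countable_iff_ordLeq_natLeq[symmetric])
  then have "countable \<B>"
    using \<B>(2) countable_iff_ordLeq_natLeq ordLeq_transitive by blast
  then show ?thesis
    using \<B>(1) second_countable by blast
qed

text \<open>Closures in metrizable spaces are reached by sequences. This countable tightness ties
  closures to countable subsets of a dense set, hence to SCH+ and to uncountable cofinality.\<close>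

lemma closure_of_countable_subset:
  assumes "metrizable_space X" "x \<in> X closure_of S"
  obtains c where "countable c" "c \<subseteq> S" "x \<in> X closure_of c"
proof -
  obtain M d where "Metric_space M d" and Xeq: "X = Metric_space.mtopology M d"
    using assms(1) unfolding metrizable_space_def by blast
  then interpret Metric_space M d
    by blast
  obtain \<sigma> where \<sigma>: "range \<sigma> \<subseteq> S \<inter> M" "limitin mtopology \<sigma> x sequentially" "x \<in> M"
    using assms(2) unfolding Xeq closure_of_sequentially by blast
  have "x \<in> X closure_of (range \<sigma>)"
    unfolding Xeq closure_of_sequentially using \<sigma> by auto
  then show thesis
    using \<sigma> by (intro that[of "range \<sigma>"]) auto
qed

section \<open>Partitions into Polish subspaces\<close>

text \<open>The number of pieces is only bounded, by a cardinal on any type, so that bounds can be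
  enlarged and absorbed. \<open>S\<close> is an arbitrary subset because the sets to be partitioned
  need be neither open nor closed.\<close>

definition Polish_partitionable :: "'a topology \<Rightarrow> 'b rel \<Rightarrow> 'a set \<Rightarrow> bool" where
  "Polish_partitionable X \<tau> S \<longleftrightarrow>
    (\<exists>\<F>\<subseteq>Polish_subspaces X. partition_on S \<F> \<and> |\<F>| \<le>o \<tau>)"

lemma Polish_partitionable_mono:
  "Polish_partitionable X \<tau> S \<Longrightarrow> \<tau> \<le>o \<tau>' \<Longrightarrow> Polish_partitionable X \<tau>' S"
  unfolding Polish_partitionable_def using ordLeq_transitive by blast

lemma Polish_subspaces_subtopology:
  "Polish_subspaces (subtopology X V) \<subseteq> Polish_subspaces X"
proof
  fix P assume "P \<in> Polish_subspaces (subtopology X V)"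
  then have "P \<subseteq> topspace X" "P \<subseteq> V" "Polish_space (subtopology (subtopology X V) P)"
    by (auto simp: Polish_subspaces_def)
  then show "P \<in> Polish_subspaces X"
    by (simp add: Polish_subspaces_def subtopology_subtopology Int_absorb1)
qed

lemma Polish_partitionable_subtopology:
  "Polish_partitionable (subtopology X V) \<tau> S \<Longrightarrow> Polish_partitionable X \<tau> S"
  unfolding Polish_partitionable_def using Polish_subspaces_subtopology by blast

lemma Polish_partitionable_separable:
  assumes "completely_metrizable_space X" "separable_space X" "Cinfinite \<tau>"
  shows "Polish_partitionable X \<tau> (topspace X)"
proof -
  have "topspace X \<in> Polish_subspaces X"
    using assms by (simp add: Polish_subspaces_def Polish_space_def)
  \<comment> \<open>Blocks of a partition are nonempty, so the empty space gets the empty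
    partition.\<close>
  moreover have "partition_on (topspace X) ({topspace X} - {{}})"
    by (auto simp: partition_on_def disjoint_def)
  moreover have "|{topspace X} - {{}}| \<le>o \<tau>"
    using assms(3) by (intro ordLess_imp_ordLeq finite_ordLess_infinite)
      (auto simp: cinfinite_def Field_card_of card_of_well_order_on card_order_on_well_order_on)
  ultimately show ?thesis
    unfolding Polish_partitionable_def by (intro exI[of _ "{topspace X} - {{}}"] conjI) auto
qed

section \<open>Traces and unions of partitioned sets\<close>

lemma Polish_subspaces_gdelta:
  assumes "P \<in> Polish_subspaces X" "gdelta_in X G"
  shows "P \<inter> G \<in> Polish_subspaces X"
proof -
  let ?Y = "subtopology X P"
  have P: "P \<subseteq> topspace X" "separable_space ?Y" "completely_metrizable_space ?Y"
    using assms(1) by (simp_all add: Polish_subspaces_def Polish_space_def)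
  have "gdelta_in ?Y (P \<inter> G)"
    unfolding gdelta_in_subtopology using assms(2) by (intro exI[of _ G]) (simp add: Int_commute)
  then have "completely_metrizable_space (subtopology ?Y (P \<inter> G))"
    by (rule completely_metrizable_space_gdelta_in[OF P(3)])
  \<comment> \<open>Separability need not pass to subspaces, but second countability does.\<close>
  moreover have "second_countable ?Y"
    by (intro separable_metrizable_imp_second_countable
        completely_metrizable_imp_metrizable_space P)
  then have "separable_space (subtopology ?Y (P \<inter> G))"
    by (rule second_countable_imp_separable_space[OF second_countable_subtopology])
  moreover have "subtopology ?Y (P \<inter> G) = subtopology X (P \<inter> G)"
    by (simp add: subtopology_subtopology Int_absorb1)
  moreover have "P \<inter> G \<subseteq> topspace X"
    using P(1) by (rule order_trans[OF Int_lower1])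
  ultimately show ?thesis
    by (simp add: Polish_subspaces_def Polish_space_def)
qed

lemma Polish_partitionable_gdelta:
  assumes "Polish_partitionable X \<tau> S" "gdelta_in X G"
  shows "Polish_partitionable X \<tau> (S \<inter> G)"
proof -
  obtain \<F> where \<F>: "\<F> \<subseteq> Polish_subspaces X" "partition_on S \<F>" "|\<F>| \<le>o \<tau>"
    using assms(1) unfolding Polish_partitionable_def by blast
  let ?\<F>' = "(\<lambda>P. P \<inter> G) ` \<F> - {{}}"
  have "?\<F>' \<subseteq> Polish_subspaces X"
    using \<F>(1) assms(2) Polish_subspaces_gdelta by blast
  moreover have "partition_on (S \<inter> G) ?\<F>'"
    using \<F>(2) unfolding partition_on_def disjoint_def by auto
  moreover have "|?\<F>'| \<le>o |(\<lambda>P. P \<inter> G) ` \<F>|"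
    by (rule card_of_mono1) auto
  then have "|?\<F>'| \<le>o \<tau>"
    using card_of_image \<F>(3) ordLeq_transitive by blast
  ultimately show ?thesis
    unfolding Polish_partitionable_def by blast
qed

lemma Polish_partitionable_disjoint_UN:
  fixes \<tau> :: "'b rel"
  assumes "Cinfinite \<tau>" "|I| \<le>o \<tau>" "disjoint_family_on P I"
    and "\<And>i. i \<in> I \<Longrightarrow> Polish_partitionable X \<tau> (P i)"
  shows "Polish_partitionable X \<tau> (\<Union>i\<in>I. P i)"
proof -
  have "\<forall>i\<in>I. \<exists>\<F>. \<F> \<subseteq> Polish_subspaces X \<and> partition_on (P i) \<F> \<and> |\<F>| \<le>o \<tau>"
    using assms(4) unfolding Polish_partitionable_def by simp
  from bchoice[OF this] obtain \<F> where
    "\<forall>i\<in>I. \<F> i \<subseteq> Polish_subspaces X \<and> partition_on (P i) (\<F> i) \<and> |\<F> i| \<le>o \<tau>"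
    by (elim exE)
  then have \<F>: "\<And>i. i \<in> I \<Longrightarrow> \<F> i \<subseteq> Polish_subspaces X"
    "\<And>i. i \<in> I \<Longrightarrow> partition_on (P i) (\<F> i)" "\<And>i. i \<in> I \<Longrightarrow> |\<F> i| \<le>o \<tau>"
    by simp_all
  have "partition_on (\<Union>i\<in>I. P i) (\<Union>i\<in>I. \<F> i)"
  proof (rule partition_onI)
    show "\<Union>(\<Union>i\<in>I. \<F> i) = (\<Union>i\<in>I. P i)"
      using partition_onD1[OF \<F>(2)] by auto
    show "{} \<notin> (\<Union>i\<in>I. \<F> i)"
      using partition_onD3[OF \<F>(2)] by auto
    fix A B assume "A \<in> (\<Union>i\<in>I. \<F> i)" "B \<in> (\<Union>i\<in>I. \<F> i)" "A \<noteq> B"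
    then obtain i j where ij: "i \<in> I" "j \<in> I" "A \<in> \<F> i" "B \<in> \<F> j"
      by blast
    show "disjnt A B"
    proof (cases "i = j")
      case True
      then show ?thesis
        using ij \<open>A \<noteq> B\<close> partition_onD2[OF \<F>(2)[OF ij(1)]]
        by (simp add: pairwise_def disjoint_def disjnt_def)
    next
      case False
      then have "P i \<inter> P j = {}"
        using assms(3) ij by (simp add: disjoint_family_on_def)
      moreover have "A \<subseteq> P i" "B \<subseteq> P j"
        using partition_onD1[OF \<F>(2)] ij by auto
      ultimately show ?thesis
        by (auto simp: disjnt_def)
    qed
  qed
  moreover have "|\<Union>i\<in>I. \<F> i| \<le>o \<tau>"
    using assms(1,2) \<F>(3) by (intro UNION_Cinfinite_bound) auto
  ultimately show ?thesis
    using \<F>(1) unfolding Polish_partitionable_def by (intro exI[of _ "\<Union>i\<in>I. \<F> i"]) auto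
qed

text \<open>Subtract from each \<open>S i\<close> the union of the earlier sets. That union is
  F-sigma, so its complement is G-delta and cuts the pieces of \<open>S i\<close> into Polish ones;
  every point falls into the difference at the first \<open>S i\<close> that contains it.\<close>

lemma Polish_partitionable_well_ordered_UN:
  fixes \<tau> :: "'b rel" and r :: "'i rel"
  assumes "Cinfinite \<tau>" "|T| \<le>o \<tau>" "Well_order r" "T \<subseteq> Field r"
    and "\<And>i. i \<in> T \<Longrightarrow> Polish_partitionable X \<tau> (S i)"
    and "\<And>i. i \<in> T \<Longrightarrow> fsigma_in X (\<Union>j\<in>T \<inter> underS r i. S j)"
    and "\<And>i. i \<in> T \<Longrightarrow> S i \<subseteq> topspace X"
  shows "Polish_partitionable X \<tau> (\<Union>i\<in>T. S i)"
proof -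
  define P where "P i = S i \<inter> (topspace X - (\<Union>j\<in>T \<inter> underS r i. S j))" for i
  have "disjoint_family_on P T"
    unfolding disjoint_family_on_def
  proof (intro ballI impI)
    fix i j assume "i \<in> T" "j \<in> T" "i \<noteq> j"
    then have "i \<in> underS r j \<or> j \<in> underS r i"
      using underS_linear[OF assms(3)] assms(4) by blast
    then show "P i \<inter> P j = {}"
      using \<open>i \<in> T\<close> \<open>j \<in> T\<close> by (auto simp: P_def)
  qed
  moreover have "Polish_partitionable X \<tau> (P i)" if "i \<in> T" for i
    unfolding P_def using assms(5,6)[OF that]
    by (intro Polish_partitionable_gdelta) (auto simp: fsigma_in_gdelta_in)
  ultimately have "Polish_partitionable X \<tau> (\<Union>i\<in>T. P i)"
    by (intro Polish_partitionable_disjoint_UN assms(1,2)) auto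
  moreover have "(\<Union>i\<in>T. P i) = (\<Union>i\<in>T. S i)"
  proof
    show "(\<Union>i\<in>T. S i) \<subseteq> (\<Union>i\<in>T. P i)"
    proof
      fix x assume "x \<in> (\<Union>i\<in>T. S i)"
      then have *: "{i \<in> T. x \<in> S i} \<subseteq> Field r" "{i \<in> T. x \<in> S i} \<noteq> {}"
        using assms(4) by auto
      obtain i where i: "i \<in> {i \<in> T. x \<in> S i}"
        "\<forall>j\<in>{i \<in> T. x \<in> S i}. j \<notin> underS r i"
        using Well_order_minimal[OF assms(3) *] by blast
      then have "x \<in> P i"
        using assms(7) by (auto simp: P_def)
      then show "x \<in> (\<Union>i\<in>T. P i)"
        using i(1) by blast
    qed
  qed (auto simp: P_def)
  ultimately show ?thesis
    by simp
qed

lemma fsigma_in_closed_UN: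
  "countable I \<Longrightarrow> (\<And>i. i \<in> I \<Longrightarrow> closedin X (S i)) \<Longrightarrow> fsigma_in X (\<Union>i\<in>I. S i)"
  by (intro fsigma_in_Union) (auto simp: closed_imp_fsigma_in)

lemma Polish_partitionable_closed_UN:
  fixes \<tau> :: "'b rel" and S :: "nat \<Rightarrow> 'a set"
  assumes "Cinfinite \<tau>" "\<And>n. closedin X (S n)" "\<And>n. Polish_partitionable X \<tau> (S n)"
  shows "Polish_partitionable X \<tau> (\<Union>n. S n)"
proof (rule Polish_partitionable_well_ordered_UN[OF assms(1) _ natLeq_Well_order])
  show "|UNIV :: nat set| \<le>o \<tau>"
    using card_of_nat natLeq_ordLeq_cinfinite[OF assms(1)] ordIso_ordLeq_trans by blast
  show "fsigma_in X (\<Union>j\<in>UNIV \<inter> underS natLeq i. S j)" for i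
    using assms(2) by (intro fsigma_in_closed_UN) auto
qed (use assms in \<open>auto simp: Field_natLeq dest: closedin_subset\<close>)

section \<open>Closed unbounded subsets of a successor cardinal\<close>

lemma underS_subset_Field: "underS r a \<subseteq> Field r"
  by (auto simp: underS_def Field_def)

lemma cardSuc_infinite_limit:
  assumes "Card_order \<kappa>" "infinite (Field \<kappa>)" "a \<in> Field (cardSuc \<kappa>)"
  shows "\<exists>b\<in>Field (cardSuc \<kappa>). a \<in> underS (cardSuc \<kappa>) b"
  using infinite_Card_order_limit[OF cardSuc_Card_order[OF assms(1)] _ assms(3)]
    cardSuc_finite[OF assms(1)] assms(2) by (auto simp: underS_def)

text \<open>Regularity of the successor cardinal in strict form: the segments form a chain covering
  \<open>Z\<close>, so \<open>cardSuc_UNION\<close> puts \<open>Z\<close> into one of them.\<close>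

lemma cardSuc_bounded:
  fixes \<kappa> :: "'a rel"
  assumes \<kappa>: "Card_order \<kappa>" "infinite (Field \<kappa>)"
    and Z: "Z \<subseteq> Field (cardSuc \<kappa>)" "|Z| \<le>o \<kappa>"
  shows "\<exists>a\<in>Field (cardSuc \<kappa>). Z \<subseteq> underS (cardSuc \<kappa>) a"
proof (rule cardSuc_UNION[OF \<kappa> _ _ Z(2)])
  have wo: "Well_order (cardSuc \<kappa>)"
    by (rule cardSuc_Well_order[OF \<kappa>(1)])
  show "relChain (cardSuc \<kappa>) (underS (cardSuc \<kappa>))"
    unfolding relChain_def rel_iff_underS[OF wo] using underS_trans[OF wo] by blast
  show "Z \<subseteq> (\<Union>i\<in>Field (cardSuc \<kappa>). underS (cardSuc \<kappa>) i)"
    using Z(1) cardSuc_infinite_limit[OF \<kappa>] by blast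
qed

text \<open>By minimality of \<open>\<delta>\<close>, no point below it bounds \<open>Z\<close>
  strictly. If \<open>Z\<close> has no largest element, \<open>\<delta>\<close> is its
  supremum.\<close>

lemma least_strict_upper_bound:
  assumes "Well_order r" "\<alpha> \<in> Field r" "Z \<subseteq> underS r \<alpha>"
  obtains \<delta> where "\<delta> \<in> Field r" "Z \<subseteq> underS r \<delta>"
    "\<And>\<gamma>. \<gamma> \<in> underS r \<delta> \<Longrightarrow> \<exists>z\<in>Z. \<gamma> = z \<or> \<gamma> \<in> underS r z"
proof -
  let ?A = "{\<delta> \<in> Field r. Z \<subseteq> underS r \<delta>}"
  have "?A \<subseteq> Field r" "?A \<noteq> {}"
    using assms by auto
  from Well_order_minimal[OF assms(1) this] obtain \<delta> where
    \<delta>: "\<delta> \<in> Field r" "Z \<subseteq> underS r \<delta>" "\<forall>\<gamma>\<in>?A. \<gamma> \<notin> underS r \<delta>"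
    by blast
  have "\<exists>z\<in>Z. \<gamma> = z \<or> \<gamma> \<in> underS r z" if \<gamma>: "\<gamma> \<in> underS r \<delta>" for \<gamma>
  proof -
    have "\<gamma> \<in> Field r"
      using \<gamma> underS_subset_Field[of r \<delta>] by blast
    then obtain z where z: "z \<in> Z" "z \<notin> underS r \<gamma>"
      using \<gamma> \<delta>(3) by blast
    then have "z \<in> Field r"
      using \<delta>(2) underS_subset_Field[of r \<delta>] by blast
    then show ?thesis
      using z underS_linear[OF assms(1) \<open>\<gamma> \<in> Field r\<close>] by blast
  qed
  then show thesis
    using \<delta> that by blast
qed

text \<open>The last premise makes \<open>\<delta>\<close> a limit and \<open>E\<close> unbounded
  below it, so closedness of the club applies.\<close>

lemma club_limit:
  assumes "Well_order r" "club r E" "\<delta> \<in> Field r" "underS r \<delta> \<noteq> {}"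
    and "\<And>\<gamma>. \<gamma> \<in> underS r \<delta> \<Longrightarrow> \<exists>\<epsilon>\<in>E \<inter> underS r \<delta>. \<gamma> \<in> underS r \<epsilon>"
  shows "\<delta> \<in> E"
proof -
  have "limit_ord r \<delta>"
    unfolding limit_ord_def using assms(4,5) by blast
  moreover have "unbounded_in (seg r \<delta>) (E \<inter> underS r \<delta>)"
    unfolding unbounded_in_seg_iff[OF assms(1)]
    using assms(5) underS_asym[OF assms(1)] by blast
  ultimately show ?thesis
    using assms(2,3) unfolding club_def by blast
qed

text \<open>Iterate \<omega> times: each step moves to a point of \<open>E\<close> above all sets
  \<open>B \<gamma>\<close> met so far, which regularity allows. The supremum of the steps lies in
  \<open>E\<close> and is closed under \<open>B\<close>.\<close>

lemma closure_points:
  fixes \<kappa> :: "'a rel" and B :: "'a set \<Rightarrow> 'a set set"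
  defines "r \<equiv> cardSuc \<kappa>"
  assumes \<kappa>: "Card_order \<kappa>" "infinite (Field \<kappa>)" and club: "club r E"
    and B: "\<And>\<alpha>. \<alpha> \<in> Field r \<Longrightarrow> B \<alpha> \<subseteq> Field r" "\<And>\<alpha>. \<alpha> \<in> Field r \<Longrightarrow> |B \<alpha>| \<le>o \<kappa>"
    and \<xi>: "\<xi> \<in> Field r"
  shows "\<exists>\<alpha>\<in>E. \<xi> \<in> underS r \<alpha> \<and> (\<forall>\<beta>\<in>underS r \<alpha>. B \<beta> \<subseteq> underS r \<alpha>)"
proof -
  have wo: "Well_order r" and cr: "Card_order r"
    using cardSuc_Card_order[OF \<kappa>(1)] by (auto simp: r_def card_order_on_well_order_on)
  have Cinf: "Cinfinite \<kappa>"
    using \<kappa> by (simp add: cinfinite_def)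
  have bounded: "\<exists>a\<in>Field r. Z \<subseteq> underS r a" if "Z \<subseteq> Field r" "|Z| \<le>o \<kappa>" for Z
    using cardSuc_bounded[OF \<kappa>] that by (simp add: r_def)
  have E: "E \<subseteq> Field r" "\<And>a. a \<in> Field r \<Longrightarrow> \<exists>b\<in>E. a = b \<or> a \<in> underS r b"
    using club unfolding club_def unbounded_in_def rel_iff_underS[OF wo] by blast+
  \<comment> \<open>One step of the iteration. It treats all \<open>\<gamma>\<close> up to and
    including \<open>\<beta>\<close>: these are at most \<open>\<kappa>\<close> sets of size at most
    \<open>\<kappa>\<close>, so their union is bounded.\<close>
  have "\<exists>b\<in>E. \<beta> \<in> underS r b \<and> (\<forall>\<gamma>\<in>insert \<beta> (underS r \<beta>). B \<gamma> \<subseteq> underS r b)"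
    if \<beta>: "\<beta> \<in> Field r" for \<beta>
  proof -
    let ?I = "insert \<beta> (underS r \<beta>)"
    have I: "?I \<subseteq> Field r"
      using \<beta> underS_subset_Field[of r \<beta>] by blast
    have "|underS r \<beta>| \<le>o \<kappa>"
      using card_of_underS[OF cr \<beta>] cardSuc_ordLeq_ordLess[OF \<kappa>(1) card_of_Card_order]
      unfolding r_def by blast
    moreover have "|{\<beta>}| \<le>o \<kappa>"
      using \<kappa>(2) by (intro Card_order_singl_ordLeq \<kappa>(1)) auto
    ultimately have cI: "|{\<beta>} \<union> underS r \<beta>| \<le>o \<kappa>"
      using Cinf by (intro Un_Cinfinite_bound)
    then have "|\<Union>\<gamma>\<in>?I. B \<gamma>| \<le>o \<kappa>"
      using B(2) I by (intro UNION_Cinfinite_bound Cinf) auto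
    with \<open>|{\<beta>}| \<le>o \<kappa>\<close> have "|{\<beta>} \<union> (\<Union>\<gamma>\<in>?I. B \<gamma>)| \<le>o \<kappa>"
      using Cinf by (intro Un_Cinfinite_bound)
    moreover have "{\<beta>} \<union> (\<Union>\<gamma>\<in>?I. B \<gamma>) \<subseteq> Field r"
      using B(1) I by blast
    ultimately obtain a where a: "a \<in> Field r" "{\<beta>} \<union> (\<Union>\<gamma>\<in>?I. B \<gamma>) \<subseteq> underS r a"
      using bounded by blast
    obtain b where b: "b \<in> E" "a = b \<or> a \<in> underS r b"
      using E(2)[OF a(1)] by blast
    have "underS r a \<subseteq> underS r b"
      using b(2) underS_trans[OF wo] by blast
    then have "{\<beta>} \<union> (\<Union>\<gamma>\<in>?I. B \<gamma>) \<subseteq> underS r b"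
      using a(2) by (rule order_trans[rotated])
    then show ?thesis
      using b(1) by blast
  qed
  then obtain g where g: "\<And>\<beta>. \<beta> \<in> Field r \<Longrightarrow> g \<beta> \<in> E"
    "\<And>\<beta>. \<beta> \<in> Field r \<Longrightarrow> \<beta> \<in> underS r (g \<beta>)"
    "\<And>\<beta> \<gamma>. \<beta> \<in> Field r \<Longrightarrow> \<gamma> \<in> insert \<beta> (underS r \<beta>) \<Longrightarrow> B \<gamma> \<subseteq> underS r (g \<beta>)"
    by metis
  define s where "s n = (g ^^ n) \<xi>" for n
  have sF: "s n \<in> Field r" for n
    by (induction n) (use \<xi> g(1) E(1) in \<open>auto simp: s_def\<close>)
  have sS: "s (Suc n) = g (s n)" for n
    by (simp add: s_def)
  have "countable (range s)"
    by simp
  then have "|range s| \<le>o natLeq"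
    by (simp only: countable_iff_ordLeq_natLeq)
  then have "|range s| \<le>o \<kappa>"
    using natLeq_ordLeq_cinfinite[OF Cinf] ordLeq_transitive by blast
  moreover have "range s \<subseteq> Field r"
    using sF by blast
  ultimately obtain a where a: "a \<in> Field r" "range s \<subseteq> underS r a"
    using bounded by blast
  \<comment> \<open>The point \<open>a\<close> only shows that the sequence is bounded;
    \<open>\<delta>\<close> is its supremum, so every point below \<open>\<delta>\<close> is at or
    below some \<open>s n\<close>.\<close>
  obtain \<delta> where \<delta>: "\<delta> \<in> Field r" "range s \<subseteq> underS r \<delta>"
    "\<And>\<gamma>. \<gamma> \<in> underS r \<delta> \<Longrightarrow> \<exists>z\<in>range s. \<gamma> = z \<or> \<gamma> \<in> underS r z"
    by (rule least_strict_upper_bound[OF wo a]) (rule that; assumption)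
  have below: "\<exists>n. \<gamma> \<in> insert (s n) (underS r (s n))" if "\<gamma> \<in> underS r \<delta>" for \<gamma>
    using \<delta>(3)[OF that] by blast
  have "\<delta> \<in> E"
  proof (rule club_limit[OF wo club \<delta>(1)])
    show "underS r \<delta> \<noteq> {}"
      using \<delta>(2) by blast
    fix \<gamma> assume "\<gamma> \<in> underS r \<delta>"
    then obtain n where "\<gamma> \<in> insert (s n) (underS r (s n))"
      using below by blast
    then have "\<gamma> \<in> underS r (s (Suc n))"
      using g(2)[OF sF[of n]] underS_trans[OF wo] unfolding sS by blast
    moreover have "s (Suc n) \<in> E \<inter> underS r \<delta>"
      using g(1)[OF sF[of n]] \<delta>(2) unfolding sS[symmetric] by blast
    ultimately show "\<exists>\<epsilon>\<in>E \<inter> underS r \<delta>. \<gamma> \<in> underS r \<epsilon>"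
      by blast
  qed
  moreover have "\<xi> \<in> underS r \<delta>"
    using \<delta>(2) rangeI[of s 0] by (auto simp: s_def)
  moreover have "B \<beta> \<subseteq> underS r \<delta>" if "\<beta> \<in> underS r \<delta>" for \<beta>
  proof -
    obtain n where "\<beta> \<in> insert (s n) (underS r (s n))"
      using below[OF \<open>\<beta> \<in> underS r \<delta>\<close>] by blast
    then have "B \<beta> \<subseteq> underS r (s (Suc n))"
      using g(3)[OF sF[of n]] unfolding sS by blast
    moreover have "s (Suc n) \<in> underS r \<delta>"
      using \<delta>(2) by blast
    ultimately show ?thesis
      using underS_trans[OF wo] by blast
  qed
  ultimately show ?thesis
    by blast
qed

section \<open>Points of uncountable cofinality in a closed unbounded set\<close>

lemma uncountably_cofinal_strict:
  "uncountably_cofinal r I \<Longrightarrow> \<gamma> \<in> I \<Longrightarrow> \<exists>a\<in>I. \<gamma> \<in> underS r a"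
  using uncountably_cofinalD[of r I "{\<gamma>}"] by simp

lemma uncountably_cofinal_nonempty: "uncountably_cofinal r I \<Longrightarrow> I \<noteq> {}"
  using uncountably_cofinalD[of r I "{}"] by auto

text \<open>Take the least \<open>\<delta>\<close> below which \<open>E\<close> has uncountably many
  points above \<open>\<xi>\<close>. Earlier segments contain only countably many, so a countable
  set unbounded in \<open>\<delta>\<close> would make the total countable. The same count shows that
  these points accumulate at \<open>\<delta>\<close>, and closedness puts \<open>\<delta>\<close>
  into \<open>E\<close>.\<close>

lemma uncountably_cofinal_points_unbounded:
  fixes \<kappa> :: "'a rel"
  defines "r \<equiv> cardSuc \<kappa>"
  assumes \<kappa>: "Card_order \<kappa>" "natLeq <o \<kappa>" and EF: "E \<subseteq> Field r"
    and unb: "\<And>\<xi>. \<xi> \<in> Field r \<Longrightarrow> \<exists>\<alpha>\<in>E. \<xi> \<in> underS r \<alpha>"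
    and closed: "\<And>\<delta>. \<delta> \<in> Field r \<Longrightarrow> underS r \<delta> \<noteq> {} \<Longrightarrow>
      (\<And>\<gamma>. \<gamma> \<in> underS r \<delta> \<Longrightarrow> \<exists>\<epsilon>\<in>E \<inter> underS r \<delta>. \<gamma> \<in> underS r \<epsilon>) \<Longrightarrow> \<delta> \<in> E"
    and \<xi>: "\<xi> \<in> Field r"
  shows "\<exists>\<alpha>\<in>E. uncountably_cofinal r (underS r \<alpha>) \<and> \<xi> \<in> underS r \<alpha>"
proof -
  have inf: "infinite (Field \<kappa>)"
    using \<kappa> natLeq_ordLeq_cinfinite
    by (metis Field_natLeq card_of_Field_ordIso finite_iff_ordLess_natLeq infinite_UNIV_nat
        not_ordLess_ordLeq ordIso_symmetric ordLess_imp_ordLeq ordLess_ordIso_trans)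
  have wo: "Well_order r"
    unfolding r_def by (rule cardSuc_Well_order[OF \<kappa>(1)])
  have bounded: "\<exists>a\<in>Field r. Z \<subseteq> underS r a" if "Z \<subseteq> Field r" "|Z| \<le>o \<kappa>" for Z
    using cardSuc_bounded[OF \<kappa>(1) inf] that by (simp add: r_def)
  define E' where "E' = {\<epsilon> \<in> E. \<xi> \<in> underS r \<epsilon>}"
  have E'F: "E' \<subseteq> Field r"
    using EF by (auto simp: E'_def)
  have "uncountable E'"
  proof
    assume "countable E'"
    then have "countable (insert \<xi> E')"
      by simp
    then have "|insert \<xi> E'| \<le>o natLeq"
      by (simp only: countable_iff_ordLeq_natLeq)
    then have "|insert \<xi> E'| \<le>o \<kappa>"
      using \<kappa>(2) ordLeq_ordLess_trans ordLess_imp_ordLeq by blast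
    moreover have "insert \<xi> E' \<subseteq> Field r"
      using \<xi> E'F by blast
    ultimately obtain a where a: "a \<in> Field r" "insert \<xi> E' \<subseteq> underS r a"
      using bounded by blast
    obtain \<epsilon> where "\<epsilon> \<in> E" "a \<in> underS r \<epsilon>"
      using unb[OF a(1)] by blast
    then have "\<epsilon> \<in> E'"
      using a(2) underS_trans[OF wo, of \<xi> a \<epsilon>] by (auto simp: E'_def)
    then show False
      using a(2) \<open>a \<in> underS r \<epsilon>\<close> underS_asym[OF wo] by blast
  qed
  \<comment> \<open>Such a \<open>\<delta>\<close> exists: a subset \<open>Z\<close> of
    \<open>E'\<close> of size aleph-one has size at most the uncountable \<open>\<kappa>\<close>,
    hence is bounded by some \<open>a\<close>.\<close>
  then have "cardSuc natLeq \<le>o |E'|"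
    using uncountable_iff_natLeq_ordLess cardSuc_least natLeq_Card_order card_of_Card_order by blast
  then have "|Field (cardSuc natLeq)| \<le>o |E'|"
    using card_of_Field_ordIso[OF cardSuc_Card_order[OF natLeq_Card_order]] ordIso_ordLeq_trans
    by blast
  then obtain Z where Z: "Z \<subseteq> E'" "|Field (cardSuc natLeq)| =o |Z|"
    using internalize_card_of_ordLeq[of _ "|E'|"] unfolding Field_card_of by blast
  have Zsuc: "|Z| =o cardSuc natLeq"
    using Z(2) card_of_Field_ordIso[OF cardSuc_Card_order[OF natLeq_Card_order]]
      ordIso_symmetric ordIso_transitive by blast
  have "uncountable Z"
    using Zsuc cardSuc_greater[OF natLeq_Card_order] ordIso_symmetric ordLess_ordIso_trans
    unfolding uncountable_iff_natLeq_ordLess by blast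
  have "|Z| \<le>o \<kappa>"
    using Zsuc cardSuc_least[OF natLeq_Card_order \<kappa>] ordIso_ordLeq_trans by blast
  then obtain a where a: "a \<in> Field r" "Z \<subseteq> underS r a"
    using bounded Z(1) E'F by blast
  let ?A = "{\<delta> \<in> Field r. uncountable (E' \<inter> underS r \<delta>)}"
  have "Z \<subseteq> E' \<inter> underS r a"
    using Z(1) a(2) by blast
  then have "a \<in> ?A"
    using a(1) \<open>uncountable Z\<close> countable_subset by blast
  then have A: "?A \<subseteq> Field r" "?A \<noteq> {}"
    by auto
  obtain \<delta> where \<delta>: "\<delta> \<in> ?A" "\<forall>\<gamma>\<in>?A. \<gamma> \<notin> underS r \<delta>"
    using Well_order_minimal[OF wo A] by blast
  have cnt: "countable (E' \<inter> underS r \<gamma>)" if "\<gamma> \<in> underS r \<delta>" for \<gamma>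
    using \<delta>(2) that underS_subset_Field[of r \<delta>] by blast
  have unc: "uncountable (E' \<inter> underS r \<delta>)" and \<delta>F: "\<delta> \<in> Field r"
    using \<delta>(1) by simp_all
  have ucof: "uncountably_cofinal r (underS r \<delta>)"
    unfolding uncountably_cofinal_def
  proof (intro allI impI; elim conjE)
    fix c assume c: "countable c" "c \<subseteq> underS r \<delta>"
    show "\<exists>a\<in>underS r \<delta>. c \<subseteq> underS r a"
    proof (rule ccontr)
      assume *: "\<not> ?thesis"
      have "E' \<inter> underS r \<delta> \<subseteq> c \<union> (\<Union>\<gamma>\<in>c. E' \<inter> underS r \<gamma>)"
      proof
        fix e assume e: "e \<in> E' \<inter> underS r \<delta>"
        then obtain \<gamma> where \<gamma>: "\<gamma> \<in> c" "\<gamma> \<notin> underS r e"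
          using * by blast
        moreover have "e \<in> Field r" "\<gamma> \<in> Field r"
          using e \<gamma>(1) c(2) underS_subset_Field[of r \<delta>] by auto
        ultimately have "e = \<gamma> \<or> e \<in> underS r \<gamma>"
          using underS_linear[OF wo, of e \<gamma>] by simp
        then show "e \<in> c \<union> (\<Union>\<gamma>\<in>c. E' \<inter> underS r \<gamma>)"
          using \<gamma>(1) e by auto
      qed
      moreover have "countable (c \<union> (\<Union>\<gamma>\<in>c. E' \<inter> underS r \<gamma>))"
        using c cnt by (intro countable_Un countable_UN) auto
      ultimately show False
        using unc countable_subset by blast
    qed
  qed
  have "E' \<inter> underS r \<delta> \<noteq> {}"
    using unc by (intro notI) simp
  then obtain \<epsilon> where "\<epsilon> \<in> E'" "\<epsilon> \<in> underS r \<delta>"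
    by blast
  then have "\<xi> \<in> underS r \<delta>"
    using underS_trans[OF wo] by (auto simp: E'_def)
  moreover have "\<delta> \<in> E"
  proof (rule closed[OF \<delta>F])
    show "underS r \<delta> \<noteq> {}"
      using \<open>\<xi> \<in> underS r \<delta>\<close> by blast
    fix \<gamma> assume \<gamma>: "\<gamma> \<in> underS r \<delta>"
    show "\<exists>\<epsilon>\<in>E \<inter> underS r \<delta>. \<gamma> \<in> underS r \<epsilon>"
    proof (rule ccontr)
      assume *: "\<not> ?thesis"
      have "E' \<inter> underS r \<delta> \<subseteq> insert \<gamma> (E' \<inter> underS r \<gamma>)"
      proof
        fix e assume e: "e \<in> E' \<inter> underS r \<delta>"
        then have "\<gamma> \<notin> underS r e"
          using * by (auto simp: E'_def)
        moreover have "e \<in> Field r" "\<gamma> \<in> Field r"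
          using e \<gamma> underS_subset_Field[of r \<delta>] by auto
        ultimately show "e \<in> insert \<gamma> (E' \<inter> underS r \<gamma>)"
          using underS_linear[OF wo, of e \<gamma>] e by auto
      qed
      then show False
        using unc cnt[OF \<gamma>] by (meson countable_insert countable_subset)
    qed
  qed
  ultimately show ?thesis
    using ucof by blast
qed

text \<open>The point is the supremum of \<open>I\<close>. As \<open>I\<close> has no largest
  element, it is cofinal in the supremum, which inherits uncountable cofinality from
  \<open>I\<close> and lies in \<open>E\<close> as a limit of points of \<open>E\<close>.\<close>

lemma uncountably_cofinal_points_limit:
  fixes r :: "'i rel"
  assumes wo: "Well_order r"
    and closed: "\<And>\<delta>. \<delta> \<in> Field r \<Longrightarrow> underS r \<delta> \<noteq> {} \<Longrightarrow>
      (\<And>\<gamma>. \<gamma> \<in> underS r \<delta> \<Longrightarrow> \<exists>\<epsilon>\<in>E \<inter> underS r \<delta>. \<gamma> \<in> underS r \<epsilon>) \<Longrightarrow> \<delta> \<in> E"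
    and \<alpha>: "\<alpha> \<in> Field r" "I \<subseteq> E \<inter> underS r \<alpha>" "uncountably_cofinal r I"
  shows "\<exists>\<delta>\<in>E. uncountably_cofinal r (underS r \<delta>) \<and> I \<subseteq> underS r \<delta> \<and>
    (\<forall>\<xi>\<in>underS r \<delta>. \<exists>\<beta>\<in>I. \<xi> \<in> underS r \<beta>)"
proof -
  have "I \<subseteq> underS r \<alpha>"
    using \<alpha>(2) by blast
  then obtain \<delta> where \<delta>: "\<delta> \<in> Field r" "I \<subseteq> underS r \<delta>"
    "\<And>\<gamma>. \<gamma> \<in> underS r \<delta> \<Longrightarrow> \<exists>z\<in>I. \<gamma> = z \<or> \<gamma> \<in> underS r z"
    by (rule least_strict_upper_bound[OF wo \<alpha>(1)]) (rule that; assumption)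
  have lim: "\<exists>\<beta>\<in>I. \<xi> \<in> underS r \<beta>" if "\<xi> \<in> underS r \<delta>" for \<xi>
  proof -
    obtain z where z: "z \<in> I" "\<xi> = z \<or> \<xi> \<in> underS r z"
      using \<delta>(3)[OF \<open>\<xi> \<in> underS r \<delta>\<close>] by blast
    obtain \<beta> where "\<beta> \<in> I" "z \<in> underS r \<beta>"
      using uncountably_cofinal_strict[OF \<alpha>(3) z(1)] by blast
    then show ?thesis
      using z(2) underS_trans[OF wo, of \<xi> z \<beta>] by auto
  qed
  have "uncountably_cofinal r (underS r \<delta>)"
    unfolding uncountably_cofinal_def
  proof (intro allI impI; elim conjE)
    fix c assume c: "countable c" "c \<subseteq> underS r \<delta>"
    \<comment> \<open>Push the countable set \<open>c\<close> up into \<open>I\<close>, where it has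
      a bound.\<close>
    then have "\<forall>\<xi>\<in>c. \<exists>\<beta>. \<beta> \<in> I \<and> \<xi> \<in> underS r \<beta>"
      using lim by blast
    from bchoice[OF this] obtain b where b: "\<forall>\<xi>\<in>c. b \<xi> \<in> I \<and> \<xi> \<in> underS r (b \<xi>)"
      by (elim exE)
    then have "b ` c \<subseteq> I" "countable (b ` c)"
      using c(1) by auto
    then obtain a where a: "a \<in> I" "b ` c \<subseteq> underS r a"
      using uncountably_cofinalD[OF \<alpha>(3)] by meson
    have "c \<subseteq> underS r a"
    proof
      fix x assume "x \<in> c"
      then have "x \<in> underS r (b x)" "b x \<in> underS r a"
        using a b by auto
      then show "x \<in> underS r a"
        by (rule underS_trans[OF wo])
    qed
    moreover have "a \<in> underS r \<delta>"
      using a(1) \<delta>(2) by blast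
    ultimately show "\<exists>a\<in>underS r \<delta>. c \<subseteq> underS r a"
      by blast
  qed
  moreover have "\<delta> \<in> E"
  proof (rule closed[OF \<delta>(1)])
    show "underS r \<delta> \<noteq> {}"
      using \<delta>(2) uncountably_cofinal_nonempty[OF \<alpha>(3)] by blast
    show "\<exists>\<epsilon>\<in>E \<inter> underS r \<delta>. \<gamma> \<in> underS r \<epsilon>" if "\<gamma> \<in> underS r \<delta>" for \<gamma>
      using lim[OF that] \<alpha>(2) \<delta>(2) by blast
  qed
  ultimately show ?thesis
    using \<delta>(2) lim by blast
qed

section \<open>Dominating matrices\<close>

lemma card_of_Times_ordLess:
  assumes "infinite C" "|A| <o |C|" "|B| <o |C|"
  shows "|A \<times> B| <o |C|"
proof (cases "finite (A <+> B)")
  case True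
  then have "finite (A \<times> B)"
    by simp
  then show ?thesis
    using assms(1) by (intro finite_ordLess_infinite) (auto simp: Field_card_of card_of_well_order_on)
next
  case False
  have "|A \<times> B| \<le>o |(A <+> B) \<times> (A <+> B)|"
    by (rule ordLeq_transitive[OF card_of_Times_mono1[OF card_of_Plus1]
          card_of_Times_mono2[OF card_of_Plus2]])
  also have "|(A <+> B) \<times> (A <+> B)| \<le>o |A <+> B|"
    by (intro ordIso_imp_ordLeq card_of_Times_same_infinite False)
  also have "|A <+> B| <o |C|"
    using assms by (rule card_of_Plus_ordLess_infinite)
  finally show ?thesis .
qed

text \<open>The segment of \<open>\<alpha>\<close> is the union of the countably many images of the
  sets \<open>A n\<close> under \<open>f\<close>. By uncountable cofinality one image is already
  unbounded; moving its points up into \<open>K\<close> gives the small set.\<close>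

lemma small_cofinal_subset:
  fixes A :: "nat \<Rightarrow> 'b set"
  assumes wo: "Well_order r" and ucof: "uncountably_cofinal r (underS r \<alpha>)"
    and A: "(\<Union>n. A n) = D" and f: "f ` D = underS r \<alpha>"
    and K: "K \<subseteq> underS r \<alpha>" "\<forall>b\<in>underS r \<alpha>. \<not> K \<subseteq> underS r b"
  obtains K' n where "K' \<subseteq> K" "|K'| \<le>o |A n|"
    "\<And>b. b \<in> underS r \<alpha> \<Longrightarrow> \<exists>\<eta>\<in>K'. b \<in> underS r \<eta>"
proof -
  \<comment> \<open>Otherwise the bounds \<open>b n\<close> of the images have a common strict bound
    \<open>a\<close> below \<open>\<alpha>\<close>; but \<open>a\<close> itself lies in some image,
    hence below the corresponding \<open>b n\<close>.\<close>
  have "\<exists>n. \<forall>b\<in>underS r \<alpha>. \<not> f ` A n \<subseteq> underS r b"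
  proof (rule ccontr)
    assume "\<not> ?thesis"
    then have "\<forall>n. \<exists>b. b \<in> underS r \<alpha> \<and> f ` A n \<subseteq> underS r b"
      by blast
    from choice[OF this] obtain b where b: "\<forall>n. b n \<in> underS r \<alpha> \<and> f ` A n \<subseteq> underS r (b n)"
      by (elim exE)
    then have "range b \<subseteq> underS r \<alpha>" "countable (range b)"
      by auto
    then obtain a where a: "a \<in> underS r \<alpha>" "range b \<subseteq> underS r a"
      using uncountably_cofinalD[OF ucof] by meson
    then have "a \<in> f ` (\<Union>n. A n)"
      using f A by blast
    then obtain n where "a \<in> f ` A n"
      by blast
    then have "a \<in> underS r (b n)" "b n \<in> underS r a"
      using b a(2) by auto
    then show False
      using underS_asym[OF wo] by blast
  qed
  then obtain n where n: "\<And>b. b \<in> underS r \<alpha> \<Longrightarrow> \<not> f ` A n \<subseteq> underS r b"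
    by blast
  have fA: "f ` A n \<subseteq> underS r \<alpha>"
    using f A by blast
  have "\<forall>\<xi>\<in>f ` A n. \<exists>\<eta>. \<eta> \<in> K \<and> (\<xi> = \<eta> \<or> \<xi> \<in> underS r \<eta>)"
  proof
    fix \<xi> assume "\<xi> \<in> f ` A n"
    then have \<xi>: "\<xi> \<in> underS r \<alpha>"
      using fA by blast
    then obtain \<eta> where \<eta>: "\<eta> \<in> K" "\<eta> \<notin> underS r \<xi>"
      using K(2) by blast
    moreover have "\<xi> \<in> Field r" "\<eta> \<in> Field r"
      using \<xi> \<eta>(1) K(1) underS_subset_Field[of r \<alpha>] by auto
    ultimately show "\<exists>\<eta>. \<eta> \<in> K \<and> (\<xi> = \<eta> \<or> \<xi> \<in> underS r \<eta>)"
      using underS_linear[OF wo, of \<xi> \<eta>] by blast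
  qed
  from bchoice[OF this] obtain p where
    p: "\<forall>\<xi>\<in>f ` A n. p \<xi> \<in> K \<and> (\<xi> = p \<xi> \<or> \<xi> \<in> underS r (p \<xi>))"
    by (elim exE)
  show thesis
  proof (rule that)
    show "p ` f ` A n \<subseteq> K"
      using p by blast
    show "|p ` f ` A n| \<le>o |A n|"
      by (rule ordLeq_transitive[OF card_of_image card_of_image])
    fix b assume "b \<in> underS r \<alpha>"
    \<comment> \<open>The extra point \<open>b'\<close> above \<open>b\<close> turns a non-strict
      comparison into a strict one.\<close>
    then obtain b' where b': "b' \<in> underS r \<alpha>" "b \<in> underS r b'"
      using uncountably_cofinal_strict[OF ucof] by blast
    then obtain \<xi> where \<xi>: "\<xi> \<in> f ` A n" "\<xi> \<notin> underS r b'"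
      using n by blast
    have "b' \<in> Field r" "\<xi> \<in> Field r"
      using \<xi>(1) b'(1) fA underS_subset_Field[of r \<alpha>] by auto
    then have "b' = \<xi> \<or> b' \<in> underS r \<xi>"
      using underS_linear[OF wo, of b' \<xi>] \<xi>(2) by blast
    then have "b \<in> underS r \<xi>"
      using b'(2) underS_trans[OF wo, of b b' \<xi>] by auto
    then have "b \<in> underS r (p \<xi>)"
      using p \<xi>(1) underS_trans[OF wo, of b \<xi> "p \<xi>"] by auto
    then show "\<exists>\<eta>\<in>p ` f ` A n. b \<in> underS r \<eta>"
      using \<xi>(1) by blast
  qed
qed

text \<open>Each \<open>A n\<close> is smaller than \<open>|D|\<close>, so SCH+ provides at most
  \<open>cardSuc |A n|\<close>, hence at most \<open>|D|\<close>, sets for it. A family cofinal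
  among all countable subsets of \<open>D\<close> may need \<open>cardSuc |D|\<close>
  members.\<close>

lemma small_countable_families:
  fixes A :: "nat \<Rightarrow> 'a set"
  assumes "SCH_plus TYPE('a)" "infinite D" "\<And>n. |A n| <o |D|"
  obtains \<E> where "|\<E>| \<le>o |D|" "\<And>e. e \<in> \<E> \<Longrightarrow> countable e"
    "\<And>n x. countable x \<Longrightarrow> x \<subseteq> A n \<Longrightarrow> \<exists>e\<in>\<E>. x \<subseteq> e"
proof -
  have "\<exists>\<E>. |\<E>| \<le>o |D| \<and> (\<forall>e\<in>\<E>. countable e) \<and>
      (\<forall>x. countable x \<and> x \<subseteq> A n \<longrightarrow> (\<exists>e\<in>\<E>. x \<subseteq> e))" for n
  proof (cases "finite (A n)")
    case True
    have "|{A n}| \<le>o |D|"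
      using assms(2) by (intro card_of_singl_ordLeq) auto
    then show ?thesis
      using True by (intro exI[of _ "{A n}"]) (simp add: countable_finite)
  next
    case False
    obtain \<D> where \<D>: "|\<D>| \<le>o cardSuc |A n|" "\<And>y. y \<in> \<D> \<Longrightarrow> countable y \<and> y \<subseteq> A n"
      "\<And>x. countable x \<Longrightarrow> x \<subseteq> A n \<Longrightarrow> \<exists>y\<in>\<D>. x \<subseteq> y"
      by (rule SCH_plus_cofinal_family[OF assms(1) False]) (rule that; assumption)
    have "cardSuc |A n| \<le>o |D|"
      by (intro cardSuc_least card_of_Card_order assms(3))
    then have "|\<D>| \<le>o |D|"
      using \<D>(1) ordLeq_transitive by blast
    then show ?thesis
      using \<D>(2,3) by (intro exI[of _ \<D>]) simp
  qed
  then have "\<forall>n. \<exists>\<E>. |\<E>| \<le>o |D| \<and> (\<forall>e\<in>\<E>. countable e) \<and>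
      (\<forall>x. countable x \<and> x \<subseteq> A n \<longrightarrow> (\<exists>e\<in>\<E>. x \<subseteq> e))"
    by blast
  from choice[OF this] obtain \<E> where \<E>: "\<forall>n. |\<E> n| \<le>o |D| \<and> (\<forall>e\<in>\<E> n. countable e) \<and>
      (\<forall>x. countable x \<and> x \<subseteq> A n \<longrightarrow> (\<exists>e\<in>\<E> n. x \<subseteq> e))"
    by (elim exE)
  show thesis
  proof (rule that)
    show "|\<Union>n. \<E> n| \<le>o |D|"
      using \<E> assms(2) infinite_iff_card_of_nat[of D]
      by (intro card_of_UNION_ordLeq_infinite) simp_all
    show "countable e" if "e \<in> (\<Union>n. \<E> n)" for e
      using \<E> that by blast
    fix n x assume "countable x" "x \<subseteq> A n"
    then have "\<exists>e\<in>\<E> n. x \<subseteq> e"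
      using \<E> by simp
    then show "\<exists>e\<in>(\<Union>n. \<E> n). x \<subseteq> e"
      by blast
  qed
qed

text \<open>\<open>d\<close> lists a cofinal family of countable subsets of \<open>D\<close>, and
  \<open>T\<close> consists of closure points of uncountable cofinality. At such a point the weak
  square set, thinned to a small \<open>K\<close>, together with the pieces \<open>A n\<close>
  splits the earlier indices into countably many small groups, and the closure property keeps each
  countable subset of a group's union covered before \<open>\<alpha>\<close>. The last conclusion
  provides suprema of uncountable cofinality inside \<open>T\<close>.\<close>

lemma dominating_matrix:
  fixes D :: "'a set"
  defines "r \<equiv> cardSuc |D|"
  assumes sch: "SCH_plus TYPE('a)" and square: "weak_square_omega1 |D|"
    and D: "natLeq <o |D|" "cf |D| =o natLeq"
  obtains d T where
    "\<And>\<xi>. countable (d \<xi>)" "\<And>\<xi>. d \<xi> \<subseteq> D" "T \<subseteq> Field r"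
    "\<And>x. countable x \<Longrightarrow> x \<subseteq> D \<Longrightarrow> \<exists>\<xi>\<in>Field r. x \<subseteq> d \<xi>"
    "\<And>\<xi>. \<xi> \<in> Field r \<Longrightarrow> \<exists>\<alpha>\<in>T. \<xi> \<in> underS r \<alpha>"
    "\<And>\<alpha>. \<alpha> \<in> T \<Longrightarrow> \<exists>S :: nat \<Rightarrow> 'a set. (\<forall>n. S n \<subseteq> D \<and> |S n| <o |D| ) \<and>
      (\<forall>\<xi>\<in>underS r \<alpha>. \<exists>n. d \<xi> \<subseteq> S n) \<and>
      (\<forall>n x. countable x \<and> x \<subseteq> S n \<longrightarrow> (\<exists>\<xi>\<in>underS r \<alpha>. x \<subseteq> d \<xi>))"
    "\<And>\<alpha>. \<alpha> \<in> T \<Longrightarrow> uncountably_cofinal r (T \<inter> underS r \<alpha>) \<Longrightarrow> \<exists>\<delta>\<in>T.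
      T \<inter> underS r \<alpha> \<subseteq> underS r \<delta> \<and> (\<forall>\<xi>\<in>underS r \<delta>. \<exists>\<beta>\<in>T \<inter> underS r \<alpha>. \<xi> \<in> underS r \<beta>)"
proof -
  have cD: "Card_order |D|"
    by (rule card_of_Card_order)
  have infD: "infinite D"
    using D(1) uncountable_iff_natLeq_ordLess countable_finite by blast
  then have infF: "infinite (Field |D| )"
    by (simp add: Field_card_of)
  have wo: "Well_order r" and cr: "Card_order r"
    unfolding r_def using cardSuc_Well_order[OF cD] cardSuc_Card_order[OF cD] by simp_all
  have Fne: "Field r \<noteq> {}"
    unfolding r_def by (rule Field_cardSuc_not_empty[OF cD])
  obtain \<D> where \<D>: "|\<D>| \<le>o r" "\<And>y. y \<in> \<D> \<Longrightarrow> countable y \<and> y \<subseteq> D"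
    "\<And>x. countable x \<Longrightarrow> x \<subseteq> D \<Longrightarrow> \<exists>y\<in>\<D>. x \<subseteq> y"
    by (rule SCH_plus_cofinal_family[OF sch infD, folded r_def]) (rule that; assumption)
  have "\<D> \<noteq> {}"
    using \<D>(3)[of "{}"] by auto
  moreover have "|\<D>| \<le>o |Field r|"
    by (rule ordLeq_ordIso_trans[OF \<D>(1) ordIso_symmetric[OF card_of_Field_ordIso[OF cr]]])
  ultimately obtain d0 where d0: "d0 ` Field r = \<D>"
    using card_of_ordLeq2[of \<D> "Field r"] by blast
  \<comment> \<open>The value outside the field is empty so that countability and inclusion in
    \<open>D\<close> need no side condition.\<close>
  define d where "d \<xi> = (if \<xi> \<in> Field r then d0 \<xi> else {})" for \<xi>
  have d: "countable (d \<xi>)" "d \<xi> \<subseteq> D" for \<xi>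
    using d0 \<D>(2) by (auto simp: d_def)
  have d_cofinal: "\<exists>\<xi>\<in>Field r. x \<subseteq> d \<xi>" if x: "countable x" "x \<subseteq> D" for x
  proof -
    obtain y where "y \<in> \<D>" "x \<subseteq> y"
      using \<D>(3)[OF x] by blast
    then show ?thesis
      using d0 by (force simp: d_def)
  qed
  obtain A :: "nat \<Rightarrow> 'a set" where A: "(\<Union>n. A n) = D" "\<And>n. |A n| <o |D|"
    by (rule countable_cofinality_decomposition[OF infD D(2)]) (rule that; assumption)
  obtain \<E> where \<E>: "|\<E>| \<le>o |D|" "\<And>e. e \<in> \<E> \<Longrightarrow> countable e"
    "\<And>n x. countable x \<Longrightarrow> x \<subseteq> A n \<Longrightarrow> \<exists>e\<in>\<E>. x \<subseteq> e"
    by (rule small_countable_families[OF sch infD A(2)]) (rule that; assumption)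
  \<comment> \<open>\<open>f \<xi>\<close> will enumerate the segment of \<open>\<xi>\<close>, of
    size at most \<open>|D|\<close>, along \<open>D\<close>. The empty segment is excluded, being no
    image of the nonempty \<open>D\<close>.\<close>
  have "\<forall>\<xi>. \<exists>g. \<xi> \<in> Field r \<and> underS r \<xi> \<noteq> {} \<longrightarrow> g ` D = underS r \<xi>"
  proof
    fix \<xi>
    have "|underS r \<xi>| \<le>o |D|" if "\<xi> \<in> Field r"
      using card_of_underS[OF cr that] cardSuc_ordLeq_ordLess[OF cD card_of_Card_order[of "underS r \<xi>"]]
      unfolding r_def by blast
    then show "\<exists>g. \<xi> \<in> Field r \<and> underS r \<xi> \<noteq> {} \<longrightarrow> g ` D = underS r \<xi>"
      using card_of_ordLeq2[of "underS r \<xi>" D] by blast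
  qed
  from choice[OF this] obtain f
    where f: "\<forall>\<xi>. \<xi> \<in> Field r \<and> underS r \<xi> \<noteq> {} \<longrightarrow> f \<xi> ` D = underS r \<xi>"
    by (elim exE)
  obtain C Dc where club: "club r Dc"
    and "\<forall>\<alpha>\<in>Dc. cardSuc natLeq \<le>o cf (seg r \<alpha>) \<longrightarrow>
      C \<alpha> \<subseteq> underS r \<alpha> \<and> unbounded_in (seg r \<alpha>) (C \<alpha>) \<and>
      (\<forall>x. countable x \<and> x \<subseteq> C \<alpha> \<longrightarrow>
        (\<exists>\<alpha>'\<in>underS r \<alpha>. countable (C \<alpha>') \<and> C \<alpha>' \<subseteq> underS r \<alpha> \<and> x \<subseteq> C \<alpha>'))"
    using square unfolding weak_square_omega1_def r_def[symmetric] by (elim exE conjE)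
  note C = this(2)[rule_format]
  \<comment> \<open>This set anticipates the countable subsets of the small sets below. If
    \<open>C \<alpha>\<close> and \<open>e\<close> are countable, so is \<open>G \<alpha> e\<close>,
    and cofinality of \<open>d\<close> yields an index \<open>\<zeta> \<alpha> e\<close> whose set
    contains it.\<close>
  define G where "G \<alpha> e = (\<Union>\<xi>\<in>C \<alpha>. \<Union>\<nu>\<in>e. d (f \<xi> \<nu>))" for \<alpha> e
  have G: "\<exists>\<zeta>. \<zeta> \<in> Field r \<and> G \<alpha> e \<subseteq> d \<zeta>" if "countable (C \<alpha>)" "e \<in> \<E>" for \<alpha> e
  proof -
    have "countable (G \<alpha> e)"
      unfolding G_def using that \<E>(2) d(1) by (intro countable_UN) auto
    moreover have "G \<alpha> e \<subseteq> D"
      unfolding G_def using d(2) by blast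
    ultimately show ?thesis
      using d_cofinal by blast
  qed
  define \<zeta> where "\<zeta> \<alpha> e = (SOME \<zeta>. \<zeta> \<in> Field r \<and> G \<alpha> e \<subseteq> d \<zeta>)" for \<alpha> e
  have \<zeta>: "\<zeta> \<alpha> e \<in> Field r" "G \<alpha> e \<subseteq> d (\<zeta> \<alpha> e)" if "countable (C \<alpha>)" "e \<in> \<E>" for \<alpha> e
    using someI_ex[OF G[OF that]] unfolding \<zeta>_def by blast+
  \<comment> \<open>The indices required below every closure point above \<open>\<alpha>\<close>, at
    most \<open>|D|\<close> many because \<open>\<E>\<close> is that small. Only countable
    \<open>C \<alpha>\<close> matter, since the weak square principle catches countable sets in such
    ones.\<close>
  define B where "B \<alpha> = (if countable (C \<alpha>) then \<zeta> \<alpha> ` \<E> else {})" for \<alpha>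
  have B: "B \<alpha> \<subseteq> Field r" "|B \<alpha>| \<le>o |D|" for \<alpha>
  proof -
    show "B \<alpha> \<subseteq> Field r"
      using \<zeta>(1) by (auto simp: B_def)
    have "|B \<alpha>| \<le>o |\<E>|"
      by (auto simp: B_def card_of_image card_of_empty)
    then show "|B \<alpha>| \<le>o |D|"
      by (rule ordLeq_transitive[OF _ \<E>(1)])
  qed
  define E where "E = {\<alpha> \<in> Dc. \<forall>\<beta>\<in>underS r \<alpha>. B \<beta> \<subseteq> underS r \<alpha>}"
  have EF: "E \<subseteq> Field r"
    using club by (auto simp: E_def club_def unbounded_in_def)
  have E_unb: "\<exists>\<alpha>\<in>E. \<xi> \<in> underS r \<alpha>" if "\<xi> \<in> Field r" for \<xi>
  proof -
    have "\<exists>\<alpha>\<in>Dc. \<xi> \<in> underS r \<alpha> \<and> (\<forall>\<beta>\<in>underS r \<alpha>. B \<beta> \<subseteq> underS r \<alpha>)"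
      using closure_points[OF cD infF, of Dc B \<xi>] club B that unfolding r_def by blast
    then show ?thesis
      by (auto simp: E_def)
  qed
  have E_closed: "\<delta> \<in> E" if \<delta>: "\<delta> \<in> Field r" "underS r \<delta> \<noteq> {}"
    "\<And>\<gamma>. \<gamma> \<in> underS r \<delta> \<Longrightarrow> \<exists>\<epsilon>\<in>E \<inter> underS r \<delta>. \<gamma> \<in> underS r \<epsilon>" for \<delta>
  proof -
    have "\<exists>\<epsilon>\<in>Dc \<inter> underS r \<delta>. \<gamma> \<in> underS r \<epsilon>" if "\<gamma> \<in> underS r \<delta>" for \<gamma>
      using \<delta>(3)[OF that] by (auto simp: E_def)
    then have "\<delta> \<in> Dc"
      by (rule club_limit[OF wo club \<delta>(1,2)])
    moreover have "B \<beta> \<subseteq> underS r \<delta>" if \<beta>: "\<beta> \<in> underS r \<delta>" for \<beta>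
    proof -
      obtain \<epsilon> where \<epsilon>: "\<epsilon> \<in> E" "\<epsilon> \<in> underS r \<delta>" "\<beta> \<in> underS r \<epsilon>"
        using \<delta>(3)[OF \<beta>] by blast
      then have "B \<beta> \<subseteq> underS r \<epsilon>"
        by (simp add: E_def)
      then show ?thesis
        using underS_trans[OF wo _ \<epsilon>(2)] by blast
    qed
    ultimately show ?thesis
      by (simp add: E_def)
  qed
  \<comment> \<open>The weak square clauses speak only of points of uncountable cofinality.\<close>
  define T where "T = {\<alpha> \<in> E. uncountably_cofinal r (underS r \<alpha>)}"
  have T_unb: "\<exists>\<alpha>\<in>T. \<xi> \<in> underS r \<alpha>" if "\<xi> \<in> Field r" for \<xi>
  proof -
    have "\<exists>\<alpha>\<in>E. uncountably_cofinal r (underS r \<alpha>) \<and> \<xi> \<in> underS r \<alpha>"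
      unfolding r_def
      by (rule uncountably_cofinal_points_unbounded[OF cD D(1)])
        (use EF E_unb E_closed that in \<open>simp_all add: r_def\<close>)
    then show ?thesis
      by (auto simp: T_def)
  qed
  have T_limit: "\<exists>\<delta>\<in>T. T \<inter> underS r \<alpha> \<subseteq> underS r \<delta> \<and>
      (\<forall>\<xi>\<in>underS r \<delta>. \<exists>\<beta>\<in>T \<inter> underS r \<alpha>. \<xi> \<in> underS r \<beta>)"
    if "\<alpha> \<in> T" "uncountably_cofinal r (T \<inter> underS r \<alpha>)" for \<alpha>
  proof -
    have "\<alpha> \<in> Field r" "T \<inter> underS r \<alpha> \<subseteq> E \<inter> underS r \<alpha>"
      using that(1) EF by (auto simp: T_def)
    from uncountably_cofinal_points_limit[OF wo E_closed this that(2)] show ?thesis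
      unfolding T_def by blast
  qed
  have T_small: "\<exists>S :: nat \<Rightarrow> 'a set. (\<forall>n. S n \<subseteq> D \<and> |S n| <o |D| ) \<and>
      (\<forall>\<xi>\<in>underS r \<alpha>. \<exists>n. d \<xi> \<subseteq> S n) \<and>
      (\<forall>n x. countable x \<and> x \<subseteq> S n \<longrightarrow> (\<exists>\<xi>\<in>underS r \<alpha>. x \<subseteq> d \<xi>))"
    if \<alpha>: "\<alpha> \<in> T" for \<alpha>
  proof -
    have \<alpha>E: "\<alpha> \<in> E" and \<alpha>Dc: "\<alpha> \<in> Dc" and ucof: "uncountably_cofinal r (underS r \<alpha>)"
      using \<alpha> by (auto simp: T_def E_def)
    have \<alpha>F: "\<alpha> \<in> Field r"
      using \<alpha>E EF by blast
    have "cardSuc natLeq \<le>o cf (seg r \<alpha>)"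
      using ucof cardSuc_natLeq_ordLeq_cf_seg_iff[OF wo] by blast
    from C[OF \<alpha>Dc this] have C1: "C \<alpha> \<subseteq> underS r \<alpha>"
      and C2: "\<forall>b\<in>underS r \<alpha>. \<not> C \<alpha> \<subseteq> underS r b"
      and C3: "\<And>x. countable x \<Longrightarrow> x \<subseteq> C \<alpha> \<Longrightarrow> \<exists>\<alpha>'\<in>underS r \<alpha>. countable (C \<alpha>') \<and>
        C \<alpha>' \<subseteq> underS r \<alpha> \<and> x \<subseteq> C \<alpha>'"
      unfolding unbounded_in_seg_iff[OF wo] by blast+
    have f\<alpha>: "f \<alpha> ` D = underS r \<alpha>"
      using f \<alpha>F uncountably_cofinal_nonempty[OF ucof] by simp
    \<comment> \<open>\<open>C \<alpha>\<close> may be too large; \<open>K\<close> is still cofinal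
      but smaller than \<open>|D|\<close>, and its countable subsets are countable subsets of
      \<open>C \<alpha>\<close>.\<close>
    obtain K n0 where K: "K \<subseteq> C \<alpha>" "|K| \<le>o |A n0|"
      "\<And>b. b \<in> underS r \<alpha> \<Longrightarrow> \<exists>\<eta>\<in>K. b \<in> underS r \<eta>"
      by (rule small_cofinal_subset[OF wo ucof A(1) f\<alpha> C1 C2]) (rule that; assumption)
    have cK: "|K| <o |D|"
      by (rule ordLeq_ordLess_trans[OF K(2) A(2)])
    \<comment> \<open>Each \<open>I n\<close> is smaller than \<open>|D|\<close>, and together they
      cover the segment of \<open>\<alpha>\<close>: a \<open>\<xi>\<close> below
      \<open>\<alpha>\<close> lies below some \<open>\<eta> \<in> K\<close> and hence is
      \<open>f \<eta> \<nu>\<close> for some \<open>\<nu> \<in> D\<close>.\<close>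
    define I where "I n = (\<lambda>(\<xi>, \<nu>). f \<xi> \<nu>) ` (K \<times> A n)" for n
    define S where "S n = (\<Union>\<eta>\<in>I n. d \<eta>)" for n
    have "S n \<subseteq> D \<and> |S n| <o |D|" for n
    proof
      show "S n \<subseteq> D"
        unfolding S_def using d(2) by blast
      have "|I n| \<le>o |K \<times> A n|"
        unfolding I_def by (rule card_of_image)
      also have "|K \<times> A n| <o |D|"
        by (rule card_of_Times_ordLess[OF infD cK A(2)])
      finally show "|S n| <o |D|"
        unfolding S_def by (rule card_of_UN_countable_ordLess[OF D(1)]) (rule d(1))
    qed
    moreover have "\<exists>n. d \<xi> \<subseteq> S n" if "\<xi> \<in> underS r \<alpha>" for \<xi>
    proof -
      obtain \<eta> where \<eta>: "\<eta> \<in> K" "\<xi> \<in> underS r \<eta>"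
        using K(3)[OF \<open>\<xi> \<in> underS r \<alpha>\<close>] by blast
      then have "\<eta> \<in> Field r"
        using K(1) C1 underS_subset_Field[of r \<alpha>] by blast
      then have "\<xi> \<in> f \<eta> ` (\<Union>n. A n)"
        unfolding A(1) using f \<eta>(2) by blast
      then obtain n \<nu> where "\<nu> \<in> A n" "\<xi> = f \<eta> \<nu>"
        by blast
      then have "\<xi> \<in> I n"
        unfolding I_def using \<eta>(1) by (intro image_eqI[of _ _ "(\<eta>, \<nu>)"]) auto
      then show ?thesis
        unfolding S_def by blast
    qed
    moreover have "\<exists>\<xi>\<in>underS r \<alpha>. x \<subseteq> d \<xi>" if x: "countable x" "x \<subseteq> S n" for n x
    proof -
      \<comment> \<open>Each point of \<open>x\<close> gets two coordinates. The first ones form a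
        countable subset of \<open>C \<alpha>\<close>, caught by a countable
        \<open>C \<alpha>'\<close> with \<open>\<alpha>'\<close> below \<open>\<alpha>\<close>; the
        second ones form a countable subset of \<open>A n\<close>, caught by some
        \<open>e \<in> \<E>\<close>.\<close>
      have "\<forall>y\<in>x. \<exists>p. p \<in> K \<times> A n \<and> y \<in> d (f (fst p) (snd p))"
        using x(2) unfolding S_def I_def by fastforce
      from bchoice[OF this] obtain p where
        p: "\<forall>y\<in>x. p y \<in> K \<times> A n \<and> y \<in> d (f (fst (p y)) (snd (p y)))"
        by (elim exE)
      let ?x0 = "(fst \<circ> p) ` x" and ?e0 = "(snd \<circ> p) ` x"
      have "?x0 \<subseteq> C \<alpha>" "?e0 \<subseteq> A n"
        using p K(1) by (auto simp: mem_Times_iff)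
      obtain \<alpha>' where \<alpha>': "\<alpha>' \<in> underS r \<alpha>" "countable (C \<alpha>')" "?x0 \<subseteq> C \<alpha>'"
        using C3[OF countable_image[OF x(1)] \<open>?x0 \<subseteq> C \<alpha>\<close>] by blast
      obtain e where e: "e \<in> \<E>" "?e0 \<subseteq> e"
        using \<E>(3)[OF countable_image[OF x(1)] \<open>?e0 \<subseteq> A n\<close>] by blast
      have "x \<subseteq> G \<alpha>' e"
      proof
        fix y assume y: "y \<in> x"
        then have "fst (p y) \<in> C \<alpha>'" "snd (p y) \<in> e"
          using \<alpha>'(3) e(2) by auto
        then show "y \<in> G \<alpha>' e"
          unfolding G_def using p y by blast
      qed
      also have "\<dots> \<subseteq> d (\<zeta> \<alpha>' e)"
        by (rule \<zeta>(2)[OF \<alpha>'(2) e(1)])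
      finally have "x \<subseteq> d (\<zeta> \<alpha>' e)" .
      \<comment> \<open>Closure of \<open>\<alpha>\<close> under \<open>B\<close> puts this index
        below \<open>\<alpha>\<close>.\<close>
      moreover have "\<zeta> \<alpha>' e \<in> B \<alpha>'"
        using \<alpha>'(2) e(1) by (simp add: B_def)
      then have "\<zeta> \<alpha>' e \<in> underS r \<alpha>"
        using \<alpha>E \<alpha>'(1) by (auto simp: E_def)
      ultimately show ?thesis
        by blast
    qed
    ultimately show ?thesis
      by blast
  qed
  have "T \<subseteq> Field r"
    using EF by (auto simp: T_def)
  then show thesis
    using that[of d T] d d_cofinal T_unb T_small T_limit by blast
qed

section \<open>Partitioning completely metrizable spaces\<close>

text \<open>Such an \<open>I\<close> has a countable subset without strict upper bound in
  \<open>I\<close>, and by monotonicity that subset yields the whole union. The empty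
  \<open>I\<close> and an \<open>I\<close> with a largest element are included.\<close>

lemma countably_cofinal_UN:
  assumes "Well_order r" "I \<subseteq> Field r" "\<not> uncountably_cofinal r I"
    and mono: "\<And>a b. a \<in> underS r b \<Longrightarrow> W a \<subseteq> W b"
  shows "\<exists>c\<subseteq>I. countable c \<and> (\<Union>i\<in>I. W i) = (\<Union>i\<in>c. W i)"
proof -
  from assms(3) obtain c where c: "countable c" "c \<subseteq> I" "\<not> (\<exists>a\<in>I. c \<subseteq> underS r a)"
    unfolding uncountably_cofinal_def not_all not_imp by (elim exE conjE)
  have "W i \<subseteq> (\<Union>i\<in>c. W i)" if i: "i \<in> I" for i
  proof -
    obtain \<gamma> where \<gamma>: "\<gamma> \<in> c" "\<gamma> \<notin> underS r i"
      using c(3) i by blast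
    then have "\<gamma> = i \<or> i \<in> underS r \<gamma>"
      using underS_linear[OF assms(1), of \<gamma> i] i c(2) assms(2) by blast
    then show ?thesis
      using mono[of i \<gamma>] \<gamma>(1) by blast
  qed
  then have "(\<Union>i\<in>I. W i) = (\<Union>i\<in>c. W i)"
    using c(2) by blast
  then show ?thesis
    using c(1,2) by (intro exI[of _ c] conjI)
qed

text \<open>Closures of initial segments of \<open>D\<close> cover \<open>X\<close>, because each
  point is in the closure of a countable, hence bounded, subset. The union of the closures before
  \<open>a\<close> is the closed set \<open>W a\<close> if the segment of \<open>a\<close> has
  uncountable cofinality, and a countable union of closed sets otherwise.\<close>

lemma Polish_partitionable_uncountable_cofinality:
  fixes X :: "'a topology"
  assumes X: "completely_metrizable_space X" "X closure_of D = topspace X"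
    and D: "infinite D" "natLeq <o cf |D|"
    and small: "\<And>S. S \<subseteq> D \<Longrightarrow> |S| <o |D| \<Longrightarrow> Polish_partitionable X |D| (X closure_of S)"
  shows "Polish_partitionable X |D| (topspace X)"
proof -
  let ?r = "|D|"
  have wo: "Well_order ?r"
    by (rule card_of_Well_order)
  have metr: "metrizable_space X"
    by (rule completely_metrizable_imp_metrizable_space[OF X(1)])
  define W where "W a = X closure_of (underS ?r a)" for a
  have sub: "underS ?r a \<subseteq> D" for a
    using underS_subset_Field[of ?r a] by (simp add: Field_card_of)
  have mono: "W a \<subseteq> W b" if "a \<in> underS ?r b" for a b
    unfolding W_def using underS_trans[OF wo _ that] by (intro closure_of_mono) blast
  have ucofD: "uncountably_cofinal ?r D"
    using D(2) natLeq_ordLess_cf_iff[OF wo] by (simp add: Field_card_of)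
  \<comment> \<open>Used with \<open>I = D\<close> to cover \<open>X\<close>, and with
    \<open>I\<close> a segment to see that the union of the earlier sets is closed.\<close>
  have covered: "\<exists>a\<in>I. x \<in> W a" if "uncountably_cofinal ?r I" "x \<in> X closure_of I" for x I
  proof -
    obtain c where c: "countable c" "c \<subseteq> I" "x \<in> X closure_of c"
      by (rule closure_of_countable_subset[OF metr \<open>x \<in> X closure_of I\<close>]) (rule that; assumption)
    obtain a where "a \<in> I" "c \<subseteq> underS ?r a"
      using uncountably_cofinalD[OF \<open>uncountably_cofinal ?r I\<close> c(1,2)] by blast
    then show ?thesis
      using c(3) closure_of_mono[of c "underS ?r a" X] unfolding W_def by blast
  qed
  have "Polish_partitionable X ?r (\<Union>a\<in>D. W a)"
  proof (rule Polish_partitionable_well_ordered_UN[OF Cinfinite_card_of[OF D(1)] _ wo])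
    show "|D| \<le>o ?r"
      by (rule ordIso_imp_ordLeq[OF card_of_refl])
    show "D \<subseteq> Field ?r"
      by (simp add: Field_card_of)
    fix a assume a: "a \<in> D"
    show "Polish_partitionable X ?r (W a)"
      unfolding W_def
      using card_of_underS[OF card_of_Card_order, of a D] a
      by (intro small sub) (simp add: Field_card_of)
    show "W a \<subseteq> topspace X"
      unfolding W_def by (rule closure_of_subset_topspace)
    let ?I = "underS ?r a"
    have eq: "D \<inter> ?I = ?I"
      using sub by blast
    have "fsigma_in X (\<Union>j\<in>?I. W j)"
    proof (cases "uncountably_cofinal ?r ?I")
      case True
      have "(\<Union>j\<in>?I. W j) = W a"
      proof
        show "(\<Union>j\<in>?I. W j) \<subseteq> W a"
          using mono by blast
        show "W a \<subseteq> (\<Union>j\<in>?I. W j)"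
          using covered[OF True] unfolding W_def by blast
      qed
      then show ?thesis
        by (simp add: W_def closed_imp_fsigma_in)
    next
      case False
      have "?I \<subseteq> Field ?r"
        by (rule underS_subset_Field)
      from countably_cofinal_UN[of ?r ?I W, OF wo this False mono]
      obtain c where "countable c" "c \<subseteq> ?I" "(\<Union>i\<in>?I. W i) = (\<Union>i\<in>c. W i)"
        by blast
      then show ?thesis
        by (simp add: W_def fsigma_in_closed_UN)
    qed
    then show "fsigma_in X (\<Union>j\<in>D \<inter> ?I. W j)"
      by (simp only: eq)
  qed
  moreover have "(\<Union>a\<in>D. W a) = topspace X"
  proof
    show "(\<Union>a\<in>D. W a) \<subseteq> topspace X"
      using closure_of_subset_topspace[of X] unfolding W_def by blast
    show "topspace X \<subseteq> (\<Union>a\<in>D. W a)"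
      using covered[OF ucofD] X(2) by blast
  qed
  ultimately show ?thesis
    by simp
qed

text \<open>By the matrix, \<open>W \<alpha>\<close> for \<open>\<alpha> \<in> T\<close> is a
  countable union of closures of small sets, hence F-sigma and partitionable. The union of the
  earlier sets is some \<open>W \<delta>\<close> with \<open>\<delta> \<in> T\<close> or a countable
  union of such sets, so it is F-sigma too.\<close>

lemma Polish_partitionable_countable_cofinality:
  fixes X :: "'a topology" and D :: "'a set"
  assumes X: "completely_metrizable_space X" "X closure_of D = topspace X"
    and D: "natLeq <o |D|" "cf |D| =o natLeq"
    and hyps: "SCH_plus TYPE('a)" "weak_square_omega1 |D|"
    and small: "\<And>S. S \<subseteq> D \<Longrightarrow> |S| <o |D| \<Longrightarrow> Polish_partitionable X |D| (X closure_of S)"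
  shows "Polish_partitionable X (cardSuc |D| ) (topspace X)"
proof -
  let ?r = "cardSuc |D|"
  have cD: "Card_order |D|"
    by (rule card_of_Card_order)
  have infD: "infinite D"
    using D(1) uncountable_iff_natLeq_ordLess countable_finite by blast
  have wo: "Well_order ?r" and cr: "Card_order ?r" and Cr: "Cinfinite ?r"
    using cardSuc_Well_order[OF cD] cardSuc_Card_order[OF cD]
      Cinfinite_cardSuc[OF Cinfinite_card_of[OF infD]] by simp_all
  have metr: "metrizable_space X"
    by (rule completely_metrizable_imp_metrizable_space[OF X(1)])
  obtain d T where d: "\<And>\<xi>. countable (d \<xi>)" "\<And>\<xi>. d \<xi> \<subseteq> D" and TF: "T \<subseteq> Field ?r"
    and cofinal: "\<And>x. countable x \<Longrightarrow> x \<subseteq> D \<Longrightarrow> \<exists>\<xi>\<in>Field ?r. x \<subseteq> d \<xi>"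
    and T: "\<And>\<xi>. \<xi> \<in> Field ?r \<Longrightarrow> \<exists>\<alpha>\<in>T. \<xi> \<in> underS ?r \<alpha>"
    and S: "\<And>\<alpha>. \<alpha> \<in> T \<Longrightarrow> \<exists>S :: nat \<Rightarrow> 'a set. (\<forall>n. S n \<subseteq> D \<and> |S n| <o |D| ) \<and>
      (\<forall>\<xi>\<in>underS ?r \<alpha>. \<exists>n. d \<xi> \<subseteq> S n) \<and>
      (\<forall>n x. countable x \<and> x \<subseteq> S n \<longrightarrow> (\<exists>\<xi>\<in>underS ?r \<alpha>. x \<subseteq> d \<xi>))"
    and lim: "\<And>\<alpha>. \<alpha> \<in> T \<Longrightarrow> uncountably_cofinal ?r (T \<inter> underS ?r \<alpha>) \<Longrightarrow> \<exists>\<delta>\<in>T.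
      T \<inter> underS ?r \<alpha> \<subseteq> underS ?r \<delta> \<and>
      (\<forall>\<xi>\<in>underS ?r \<delta>. \<exists>\<beta>\<in>T \<inter> underS ?r \<alpha>. \<xi> \<in> underS ?r \<beta>)"
    by (rule dominating_matrix[OF hyps D]) (rule that; assumption)
  define W where "W \<alpha> = (\<Union>\<xi>\<in>underS ?r \<alpha>. X closure_of (d \<xi>))" for \<alpha>
  have mono: "W a \<subseteq> W b" if "a \<in> underS ?r b" for a b
    unfolding W_def using underS_trans[OF wo _ that] by blast
  have W: "\<exists>S :: nat \<Rightarrow> 'a set. (\<forall>n. S n \<subseteq> D \<and> |S n| <o |D| ) \<and> W \<alpha> = (\<Union>n. X closure_of (S n))"
    if \<alpha>: "\<alpha> \<in> T" for \<alpha>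
  proof -
    obtain S :: "nat \<Rightarrow> 'a set" where S: "\<forall>n. S n \<subseteq> D \<and> |S n| <o |D|"
      "\<forall>\<xi>\<in>underS ?r \<alpha>. \<exists>n. d \<xi> \<subseteq> S n"
      "\<forall>n x. countable x \<and> x \<subseteq> S n \<longrightarrow> (\<exists>\<xi>\<in>underS ?r \<alpha>. x \<subseteq> d \<xi>)"
      using S[OF \<alpha>] by (elim exE conjE) (rule that; assumption)
    \<comment> \<open>By countable tightness a point of the closure needs only a countable part of
      \<open>S n\<close>, and this part lies in some \<open>d \<xi>\<close> with
      \<open>\<xi>\<close> below \<open>\<alpha>\<close>.\<close>
    have "X closure_of (S n) \<subseteq> W \<alpha>" for n
    proof
      fix x assume x: "x \<in> X closure_of (S n)"
      obtain c where c: "countable c" "c \<subseteq> S n" "x \<in> X closure_of c"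
        by (rule closure_of_countable_subset[OF metr x]) (rule that; assumption)
      then obtain \<xi> where "\<xi> \<in> underS ?r \<alpha>" "c \<subseteq> d \<xi>"
        using S(3) by meson
      then show "x \<in> W \<alpha>"
        using c(3) closure_of_mono[of c "d \<xi>" X] unfolding W_def by blast
    qed
    moreover have "X closure_of (d \<xi>) \<subseteq> (\<Union>n. X closure_of (S n))" if \<xi>: "\<xi> \<in> underS ?r \<alpha>" for \<xi>
    proof -
      obtain n where "d \<xi> \<subseteq> S n"
        using S(2) \<xi> by blast
      then have "X closure_of (d \<xi>) \<subseteq> X closure_of (S n)"
        by (rule closure_of_mono)
      then show ?thesis
        by blast
    qed
    ultimately have "W \<alpha> = (\<Union>n. X closure_of (S n))"
      unfolding W_def by blast
    then show ?thesis
      using S(1) by blast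
  qed
  have W_fsigma: "fsigma_in X (W \<alpha>)" if \<alpha>: "\<alpha> \<in> T" for \<alpha>
  proof -
    obtain S :: "nat \<Rightarrow> 'a set" where "W \<alpha> = (\<Union>n. X closure_of (S n))"
      using W[OF \<alpha>] by blast
    then show ?thesis
      by (simp add: fsigma_in_closed_UN)
  qed
  have "Polish_partitionable X ?r (\<Union>\<alpha>\<in>T. W \<alpha>)"
  proof (rule Polish_partitionable_well_ordered_UN[OF Cr _ wo TF])
    show "|T| \<le>o ?r"
      by (rule ordLeq_ordIso_trans[OF card_of_mono1[OF TF] card_of_Field_ordIso[OF cr]])
    fix \<alpha> assume \<alpha>: "\<alpha> \<in> T"
    obtain S :: "nat \<Rightarrow> 'a set" where S: "\<forall>n. S n \<subseteq> D \<and> |S n| <o |D|"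
      "W \<alpha> = (\<Union>n. X closure_of (S n))"
      using W[OF \<alpha>] by blast
    have "Polish_partitionable X ?r (X closure_of (S n))" for n
      using S(1) by (intro Polish_partitionable_mono[OF small cardSuc_ordLeq[OF cD]]) auto
    then show "Polish_partitionable X ?r (W \<alpha>)"
      unfolding S(2) by (intro Polish_partitionable_closed_UN[OF Cr]) auto
    show "W \<alpha> \<subseteq> topspace X"
      unfolding W_def using closure_of_subset_topspace[of X] by blast
    let ?I = "T \<inter> underS ?r \<alpha>"
    show "fsigma_in X (\<Union>j\<in>?I. W j)"
    proof (cases "uncountably_cofinal ?r ?I")
      case True
      \<comment> \<open>The supremum of \<open>?I\<close> may differ from \<open>\<alpha>\<close>,
        as \<open>T\<close> has gaps; \<open>\<delta>\<close> is a member of \<open>T\<close> in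
        which \<open>?I\<close> is cofinal, so \<open>W \<delta>\<close> is the union so
        far.\<close>
      obtain \<delta> where \<delta>: "\<delta> \<in> T" "?I \<subseteq> underS ?r \<delta>"
        "\<forall>\<xi>\<in>underS ?r \<delta>. \<exists>\<beta>\<in>?I. \<xi> \<in> underS ?r \<beta>"
        using lim[OF \<alpha> True] by blast
      have "(\<Union>j\<in>?I. W j) = W \<delta>"
      proof
        show "(\<Union>j\<in>?I. W j) \<subseteq> W \<delta>"
          using mono \<delta>(2) by blast
        show "W \<delta> \<subseteq> (\<Union>j\<in>?I. W j)"
        proof
          fix x assume "x \<in> W \<delta>"
          then obtain \<xi> where \<xi>: "\<xi> \<in> underS ?r \<delta>" "x \<in> X closure_of (d \<xi>)"
            unfolding W_def by blast
          then obtain \<beta> where "\<beta> \<in> ?I" "\<xi> \<in> underS ?r \<beta>"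
            using \<delta>(3) by blast
          then show "x \<in> (\<Union>j\<in>?I. W j)"
            using \<xi>(2) unfolding W_def by blast
        qed
      qed
      then show ?thesis
        using W_fsigma[OF \<delta>(1)] by simp
    next
      case False
      have "?I \<subseteq> Field ?r"
        using TF by blast
      from countably_cofinal_UN[of ?r ?I W, OF wo this False mono]
      obtain c where c: "countable c" "c \<subseteq> ?I" "(\<Union>i\<in>?I. W i) = (\<Union>i\<in>c. W i)"
        by blast
      show ?thesis
        unfolding c(3) using c(1,2) W_fsigma by (intro fsigma_in_Union) auto
    qed
  qed
  moreover have "(\<Union>\<alpha>\<in>T. W \<alpha>) = topspace X"
  proof
    show "(\<Union>\<alpha>\<in>T. W \<alpha>) \<subseteq> topspace X"
      using closure_of_subset_topspace[of X] unfolding W_def by blast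
    show "topspace X \<subseteq> (\<Union>\<alpha>\<in>T. W \<alpha>)"
    proof
      fix x assume "x \<in> topspace X"
      then have x: "x \<in> X closure_of D"
        by (simp add: X(2))
      obtain c where c: "countable c" "c \<subseteq> D" "x \<in> X closure_of c"
        by (rule closure_of_countable_subset[OF metr x]) (rule that; assumption)
      obtain \<xi> where \<xi>: "\<xi> \<in> Field ?r" "c \<subseteq> d \<xi>"
        using cofinal[OF c(1,2)] by blast
      obtain \<alpha> where "\<alpha> \<in> T" "\<xi> \<in> underS ?r \<alpha>"
        using T[OF \<xi>(1)] by blast
      then show "x \<in> (\<Union>\<alpha>\<in>T. W \<alpha>)"
        using c(3) closure_of_mono[OF \<xi>(2), of X] unfolding W_def by blast
    qed
  qed
  ultimately show ?thesis
    by simp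
qed

text \<open>Induction on the size of \<open>D\<close>. The weaker bound for smaller sets keeps it
  going, because \<open>|S| <o |D|\<close> gives \<open>cardSuc |S| \<le>o |D|\<close>; in
  uncountable cofinality the sharper bound then implies the weaker one.\<close>

lemma Polish_partitionable_dense:
  fixes D :: "'a set" and X :: "'a topology"
  assumes sch: "SCH_plus TYPE('a)"
    and square: "\<forall>\<mu> :: 'a rel. singular_card \<mu> \<and> cf \<mu> =o natLeq \<longrightarrow> weak_square_omega1 \<mu>"
    and "completely_metrizable_space X" "D \<subseteq> topspace X" "X closure_of D = topspace X" "infinite D"
  shows "Polish_partitionable X (cardSuc |D| ) (topspace X) \<and>
    (natLeq <o cf |D| \<longrightarrow> Polish_partitionable X |D| (topspace X))"
  using assms(3-)
proof (induction "|D|" arbitrary: D X rule: wf_induct_rule[OF wf_ordLess])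
  case (1 D X)
  note X = 1(2-4) and D = \<open>infinite D\<close>
  have cD: "Card_order |D|"
    by (rule card_of_Card_order)
  have Cinf: "Cinfinite |D|"
    by (rule Cinfinite_card_of[OF D])
  \<comment> \<open>The closure of \<open>S\<close> is a completely metrizable space with dense set
    \<open>S\<close>, so the induction hypothesis applies with \<open>S\<close> in the place of
    \<open>D\<close>.\<close>
  have small: "Polish_partitionable X |D| (X closure_of S)" if S: "S \<subseteq> D" "|S| <o |D|" for S
  proof -
    let ?Y = "subtopology X (X closure_of S)"
    have Y: "completely_metrizable_space ?Y"
      using X(1) by (rule completely_metrizable_space_closedin) simp
    have top: "topspace ?Y = X closure_of S"
      using closure_of_subset_topspace[of X S] by auto
    have SX: "S \<subseteq> X closure_of S"
      using S(1) X(2) by (intro closure_of_subset) blast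
    then have dense: "?Y closure_of S = topspace ?Y"
      unfolding closure_of_subtopology top by (simp add: Int_absorb1)
    have ST: "S \<subseteq> topspace ?Y"
      unfolding top by (rule SX)
    have "Polish_partitionable ?Y |D| (topspace ?Y)"
    proof (cases "finite S")
      case True
      then have "countable S"
        by (rule countable_finite)
      then have "separable_space ?Y"
        unfolding separable_space_def using ST dense by (intro exI[of _ S] conjI)
      then show ?thesis
        by (rule Polish_partitionable_separable[OF Y _ Cinf])
    next
      case False
      have "Polish_partitionable ?Y (cardSuc |S| ) (topspace ?Y)"
        by (rule conjunct1[OF 1(1)[OF S(2) Y ST dense False]])
      moreover have "cardSuc |S| \<le>o |D|"
        by (rule cardSuc_least[OF card_of_Card_order cD S(2)])
      ultimately show ?thesis
        by (rule Polish_partitionable_mono)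
    qed
    then show ?thesis
      unfolding top by (rule Polish_partitionable_subtopology)
  qed
  have uncountable_case: "Polish_partitionable X |D| (topspace X)" if "natLeq <o cf |D|"
    by (rule Polish_partitionable_uncountable_cofinality[OF X(1,3) D that small])
  have "Polish_partitionable X (cardSuc |D| ) (topspace X)"
  proof (cases "countable D")
    case True
    then have "separable_space X"
      unfolding separable_space_def using X(2,3) by (intro exI[of _ D] conjI)
    then show ?thesis
      by (rule Polish_partitionable_separable[OF X(1) _ Cinfinite_cardSuc[OF Cinf]])
  next
    case False
    then have unc: "natLeq <o |D|"
      by (simp only: uncountable_iff_natLeq_ordLess)
    have "infinite (Field |D| )"
      using D by (simp add: Field_card_of)
    from cD this show ?thesis
    proof (cases rule: cf_cases)
      case 1
      then show ?thesis
        by (rule Polish_partitionable_mono[OF uncountable_case cardSuc_ordLeq[OF cD]])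
    next
      case 2
      have "cf |D| <o |D|"
        by (rule ordIso_ordLess_trans[OF 2 unc])
      then have "singular_card |D|"
        using cD \<open>infinite (Field |D| )\<close> by (simp add: singular_card_def)
      then have "weak_square_omega1 |D|"
        using square 2 by blast
      then show ?thesis
        using small by (rule Polish_partitionable_countable_cofinality[OF X(1,3) unc 2 sch])
    qed
  qed
  then show ?case
    using uncountable_case by (rule conjI[OF _ impI])
qed

section \<open>Spaces of small or locally small weight\<close>

lemma Polish_partitionable_small_weight:
  fixes X :: "'a topology" and D :: "'a set"
  assumes "SCH_plus TYPE('a)"
    and "\<forall>\<mu> :: 'a rel. singular_card \<mu> \<and> cf \<mu> =o natLeq \<longrightarrow> weak_square_omega1 \<mu>"
    and X: "completely_metrizable_space X" and D: "infinite D" "wt X <o |D|"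
  shows "Polish_partitionable X |D| (topspace X)"
proof -
  \<comment> \<open>A dense set of size at most \<open>wt X\<close> is smaller than
    \<open>|D|\<close>, so the bound \<open>cardSuc |E|\<close> is at most
    \<open>|D|\<close>.\<close>
  obtain E where E: "E \<subseteq> topspace X" "X closure_of E = topspace X" "|E| \<le>o wt X"
    by (rule dense_of_wt)
  have ED: "|E| <o |D|"
    by (rule ordLeq_ordLess_trans[OF E(3) D(2)])
  show ?thesis
  proof (cases "finite E")
    case True
    then have "countable E"
      by (rule countable_finite)
    then have "separable_space X"
      unfolding separable_space_def using E(1,2) by (intro exI[of _ E] conjI)
    then show ?thesis
      by (rule Polish_partitionable_separable[OF X _ Cinfinite_card_of[OF D(1)]])
  next
    case False
    have "Polish_partitionable X (cardSuc |E| ) (topspace X)"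
      by (rule conjunct1[OF Polish_partitionable_dense[OF assms(1,2) X E(1,2) False]])
    then show ?thesis
      by (rule Polish_partitionable_mono)
        (rule cardSuc_least[OF card_of_Card_order card_of_Card_order ED])
  qed
qed

lemma Polish_partitionable_Un:
  fixes \<tau> :: "'b rel"
  assumes "Cinfinite \<tau>" "A \<inter> B = {}" "Polish_partitionable X \<tau> A" "Polish_partitionable X \<tau> B"
  shows "Polish_partitionable X \<tau> (A \<union> B)"
proof -
  let ?P = "\<lambda>b. if b then A else B"
  have "|UNIV :: bool set| \<le>o \<tau>"
    using assms(1) by (intro ordLess_imp_ordLeq finite_ordLess_infinite)
      (auto simp: cinfinite_def Field_card_of card_of_well_order_on card_order_on_well_order_on)
  moreover have "disjoint_family_on ?P UNIV"
    using assms(2) by (auto simp: disjoint_family_on_def)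
  ultimately have "Polish_partitionable X \<tau> (\<Union>b. ?P b)"
    using assms(3,4) by (intro Polish_partitionable_disjoint_UN assms(1)) auto
  moreover have "(\<Union>b. ?P b) = A \<union> B"
    by auto
  ultimately show ?thesis
    by simp
qed

text \<open>
  The open sets that can be partitioned into at most \<open>|D|\<close> Polish subspaces are closed under unions
  of \<open>|D|\<close> members, so there is a largest one; its complement, if nonempty, has a nonempty
  relatively open subset of small weight, which could be added.
\<close>

lemma Polish_partitionable_locally_less_like:
  fixes X :: "'a topology" and D :: "'a set"
  assumes hyps: "SCH_plus TYPE('a)"
      "\<forall>\<mu> :: 'a rel. singular_card \<mu> \<and> cf \<mu> =o natLeq \<longrightarrow> weak_square_omega1 \<mu>"
    and X: "completely_metrizable_space X" and D: "infinite D" "wt X \<le>o |D|"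
    and like: "\<And>S. closedin X S \<Longrightarrow> locally_less_like |D| (subtopology X S)"
  shows "Polish_partitionable X |D| (topspace X)"
proof -
  have metr: "metrizable_space X"
    by (rule completely_metrizable_imp_metrizable_space[OF X])
  have Cinf: "Cinfinite |D|"
    by (rule Cinfinite_card_of[OF D(1)])
  obtain \<B> where \<B>: "openin X = arbitrary union_of (\<lambda>U. U \<in> \<B>)" "wt X = |\<B>|"
    using wt_attained by blast
  have base: "\<forall>V\<in>\<B>. openin X V" "\<forall>U x. openin X U \<and> x \<in> U \<longrightarrow> (\<exists>V. V \<in> \<B> \<and> x \<in> V \<and> V \<subseteq> U)"
    using \<B>(1) unfolding openin_topology_base_unique by simp_all
  \<comment> \<open>The base limits the number of sets to be joined to \<open>|D|\<close>. Base sets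
    inside a partitionable open set are partitionable by taking traces, so
    \<open>\<Union>\<B>'\<close> is the largest such open set.\<close>
  define \<B>' where "\<B>' = {B \<in> \<B>. Polish_partitionable X |D| B}"
  have openB': "openin X B" if "B \<in> \<B>'" for B
    using base(1) that by (simp add: \<B>'_def)
  have "|\<B>'| \<le>o |\<B>|"
    unfolding \<B>'_def by (rule card_of_mono1) blast
  then have cB': "|\<B>'| \<le>o |D|"
    using D(2) unfolding \<B>(2) by (rule ordLeq_transitive)
  have "Polish_partitionable X |D| (\<Union>B\<in>\<B>'. B)"
  proof (rule Polish_partitionable_well_ordered_UN[OF Cinf cB' card_of_Well_order[of \<B>']])
    show "\<B>' \<subseteq> Field |\<B>'|"
      by (simp add: Field_card_of)
    fix B assume B: "B \<in> \<B>'"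
    show "Polish_partitionable X |D| B"
      using B by (simp add: \<B>'_def)
    show "B \<subseteq> topspace X"
      by (rule openin_subset[OF openB'[OF B]])
    \<comment> \<open>The union of the earlier sets is open, and open sets of a metrizable space are
      F-sigma.\<close>
    show "fsigma_in X (\<Union>j\<in>\<B>' \<inter> underS |\<B>'| B. j)"
      using openB' by (intro open_imp_fsigma_in[OF metr] openin_Union) auto
  qed
  then have part: "Polish_partitionable X |D| (\<Union>\<B>')"
    by simp
  have openU: "openin X (\<Union>\<B>')"
    using openB' by blast
  have "topspace X \<subseteq> \<Union>\<B>'"
  proof (rule ccontr)
    assume "\<not> ?thesis"
    then have "topspace X - \<Union>\<B>' \<noteq> {}"
      by blast
    define S where "S = topspace X - \<Union>\<B>'"
    have S: "closedin X S" "S \<noteq> {}"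
      using openU \<open>topspace X - \<Union>\<B>' \<noteq> {}\<close> by (auto simp: S_def)
    have top: "topspace (subtopology X S) = S"
      using closedin_subset[OF S(1)] by auto
    have "openin (subtopology X S) S"
      using openin_topspace[of "subtopology X S"] unfolding top .
    then obtain V where V: "openin (subtopology X S) V" "V \<noteq> {}"
      "wt (subtopology (subtopology X S) V) <o |D|"
      using like[OF S(1)] S(2) unfolding locally_less_like_def by blast
    let ?Y = "subtopology (subtopology X S) V"
    have "V \<subseteq> S"
      using openin_subset[OF V(1)] unfolding top .
    have "completely_metrizable_space ?Y"
      by (rule completely_metrizable_space_openin
          [OF completely_metrizable_space_closedin[OF X S(1)] V(1)])
    then have "Polish_partitionable ?Y |D| (topspace ?Y)"
      by (rule Polish_partitionable_small_weight[OF hyps _ D(1) V(3)])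
    moreover have "topspace ?Y = V"
      using openin_subset[OF V(1)] by auto
    ultimately have "Polish_partitionable X |D| V"
      by (metis Polish_partitionable_subtopology)
    moreover have "V \<inter> \<Union>\<B>' = {}"
      using \<open>V \<subseteq> S\<close> by (auto simp: S_def)
    ultimately have "Polish_partitionable X |D| (V \<union> \<Union>\<B>')"
      using part by (intro Polish_partitionable_Un[OF Cinf])
    obtain W where W: "openin X W" "V = W \<inter> S"
      using V(1) unfolding openin_subtopology by blast
    \<comment> \<open>\<open>V\<close> is open only relative to \<open>S\<close>, but
      \<open>W\<close> exceeds it only inside \<open>\<Union>\<B>'\<close>, so the enlarged set is
      open in \<open>X\<close>.\<close>
    have "V \<union> \<Union>\<B>' = W \<union> \<Union>\<B>'"
      using W openin_subset[OF W(1)] by (auto simp: S_def)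
    then have "openin X (V \<union> \<Union>\<B>')"
      using openin_Un[OF W(1) openU] by simp
    obtain x where "x \<in> V"
      using V(2) by blast
    then obtain B where B: "B \<in> \<B>" "x \<in> B" "B \<subseteq> V \<union> \<Union>\<B>'"
      using base(2) \<open>openin X (V \<union> \<Union>\<B>')\<close> by blast
    \<comment> \<open>\<open>B\<close> inherits a partition as a trace and so belongs to
      \<open>\<B>'\<close>; yet it contains \<open>x\<close>, which lies outside
      \<open>\<Union>\<B>'\<close>.\<close>
    have "Polish_partitionable X |D| ((V \<union> \<Union>\<B>') \<inter> B)"
      using \<open>Polish_partitionable X |D| (V \<union> \<Union>\<B>')\<close> base(1) B(1)
      by (intro Polish_partitionable_gdelta open_imp_gdelta_in) auto
    then have "B \<in> \<B>'"
      using B(1,3) by (simp add: \<B>'_def Int_absorb1)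
    then show False
      using \<open>x \<in> V\<close> \<open>V \<subseteq> S\<close> B(2) by (auto simp: S_def)
  qed
  moreover have "\<Union>\<B>' \<subseteq> topspace X"
    by (rule openin_subset[OF openU])
  ultimately have "\<Union>\<B>' = topspace X"
    by blast
  then show ?thesis
    using part by simp
qed

section \<open>Lower bounds for coverings\<close>

lemma Polish_subspaces_countable_dense:
  assumes "P \<in> Polish_subspaces X"
  shows "\<exists>c. countable c \<and> c \<subseteq> P \<and> P \<subseteq> X closure_of c"
proof -
  have "P \<subseteq> topspace X" "separable_space (subtopology X P)"
    using assms by (simp_all add: Polish_subspaces_def Polish_space_def)
  then obtain c where "countable c" "c \<subseteq> P" "subtopology X P closure_of c = P"
    unfolding separable_space_def by (auto simp: Int_absorb1)
  then show ?thesis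
    unfolding closure_of_subtopology by (metis Int_absorb1 Int_lower2)
qed

text \<open>Countable dense subsets of the members together form a dense subset of \<open>X\<close>;
  fewer than \<open>|D|\<close> members would push the weight below \<open>|D|\<close>.\<close>

lemma card_Polish_cover_ge:
  fixes X :: "'a topology" and D :: "'a set"
  assumes "metrizable_space X" "natLeq <o |D|" "|D| \<le>o wt X"
    and "\<F> \<subseteq> Polish_subspaces X" "\<Union>\<F> = topspace X"
  shows "|D| \<le>o |\<F>|"
proof (rule ccontr)
  assume "\<not> ?thesis"
  then have F: "|\<F>| <o |D|"
    using not_ordLess_iff_ordLeq[OF card_of_Well_order card_of_Well_order] by blast
  have "\<forall>P\<in>\<F>. \<exists>c. countable c \<and> c \<subseteq> P \<and> P \<subseteq> X closure_of c"
    using assms(4) Polish_subspaces_countable_dense by blast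
  from bchoice[OF this] obtain c where
    c: "\<forall>P\<in>\<F>. countable (c P) \<and> c P \<subseteq> P \<and> P \<subseteq> X closure_of (c P)"
    by (elim exE)
  let ?E = "\<Union>P\<in>\<F>. c P"
  have "|?E| <o |D|"
    using c by (intro card_of_UN_countable_ordLess[OF assms(2) F]) simp
  moreover have "?E \<subseteq> topspace X"
    using c assms(5) by blast
  moreover have "X closure_of ?E = topspace X"
  proof
    show "topspace X \<subseteq> X closure_of ?E"
    proof
      fix x assume "x \<in> topspace X"
      then obtain P where "P \<in> \<F>" "x \<in> P"
        using assms(5) by blast
      then have "x \<in> X closure_of (c P)" "X closure_of (c P) \<subseteq> X closure_of ?E"
        using c by (blast, intro closure_of_mono) blast
      then show "x \<in> X closure_of ?E"
        by blast
    qed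
  qed (rule closure_of_subset_topspace)
  ultimately have "wt X <o |D|"
    using wt_less_dense[OF assms(1) _ _ assms(2)] by blast
  then show False
    using assms(3) not_ordLess_ordLeq by blast
qed

text \<open>
  If \<open>|D|\<close> Polish subspaces covered \<open>X\<close>, countably many closed sets of small weight would cover an
  open subset of \<open>S\<close> that has no nonempty open subset of small weight, against Baire's theorem.
\<close>

lemma card_Polish_cover_ge_cardSuc:
  fixes X :: "'a topology" and D :: "'a set"
  assumes X: "completely_metrizable_space X" and D: "natLeq <o |D|" "cf |D| =o natLeq"
    and S: "closedin X S" "\<not> locally_less_like |D| (subtopology X S)"
    and \<F>: "\<F> \<subseteq> Polish_subspaces X" "\<Union>\<F> = topspace X"
  shows "cardSuc |D| \<le>o |\<F>|"
proof (rule ccontr)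
  assume contr: "\<not> ?thesis"
  have "|\<F>| <o cardSuc |D|"
    using contr not_ordLeq_iff_ordLess[OF card_of_Well_order cardSuc_Well_order[OF card_of_Card_order]]
    by blast
  then have F: "|\<F>| \<le>o |D|"
    using cardSuc_ordLeq_ordLess[OF card_of_Card_order card_of_Card_order] by blast
  have metr: "metrizable_space X"
    by (rule completely_metrizable_imp_metrizable_space[OF X])
  have infD: "infinite D"
    using D(1) uncountable_iff_natLeq_ordLess countable_finite by blast
  obtain U where U: "openin (subtopology X S) U" "U \<noteq> {}"
    "\<And>V. openin (subtopology X S) V \<Longrightarrow> V \<noteq> {} \<Longrightarrow> V \<subseteq> U \<Longrightarrow>
      \<not> wt (subtopology (subtopology X S) V) <o |D|"
    using S(2) unfolding locally_less_like_def by blast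
  have US: "U \<subseteq> S" "S \<subseteq> topspace X"
    using openin_subset[OF U(1)] closedin_subset[OF S(1)] by auto
  have "\<F> \<noteq> {}"
    using U(2) US \<F>(2) by blast
  \<comment> \<open>Indexing the covering by \<open>D\<close> lets the decomposition of
    \<open>D\<close> sort its members into countably many groups, each of fewer than
    \<open>|D|\<close> members.\<close>
  then obtain g where g: "g ` D = \<F>"
    using F card_of_ordLeq2[of \<F> D] by blast
  obtain A :: "nat \<Rightarrow> 'a set" where A: "(\<Union>n. A n) = D" "\<And>n. |A n| <o |D|"
    by (rule countable_cofinality_decomposition[OF infD D(2)]) (rule that; assumption)
  have "\<forall>P\<in>\<F>. \<exists>c. countable c \<and> c \<subseteq> P \<and> P \<subseteq> X closure_of c"
    using \<F>(1) Polish_subspaces_countable_dense by blast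
  from bchoice[OF this] obtain c where
    c: "\<forall>P\<in>\<F>. countable (c P) \<and> c P \<subseteq> P \<and> P \<subseteq> X closure_of (c P)"
    by (elim exE)
  \<comment> \<open>\<open>E n\<close> joins countable dense subsets of the members in the n-th
    group; its closure contains these members and has weight below \<open>|D|\<close>.\<close>
  define E where "E n = (\<Union>a\<in>A n. c (g a))" for n
  have gF: "g a \<in> \<F>" if "a \<in> A n" for a n
    using that g A(1) by blast
  have E: "|E n| <o |D|" "E n \<subseteq> topspace X" for n
  proof -
    have *: "countable (c (g a))" "c (g a) \<subseteq> topspace X" if "a \<in> A n" for a
    proof -
      show "countable (c (g a))"
        using c gF[OF that] by simp
      have "c (g a) \<subseteq> g a" "g a \<subseteq> topspace X"
        using c gF[OF that] \<F>(2) by auto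
      then show "c (g a) \<subseteq> topspace X"
        by (rule order_trans)
    qed
    show "|E n| <o |D|"
      unfolding E_def by (rule card_of_UN_countable_ordLess[OF D(1) A(2) *(1)])
    show "E n \<subseteq> topspace X"
      unfolding E_def by (rule UN_least[OF *(2)])
  qed
  let ?Q = "\<lambda>n. X closure_of (E n)"
  have cover: "\<exists>n. x \<in> ?Q n" if x: "x \<in> topspace X" for x
  proof -
    obtain P where P: "P \<in> \<F>" "x \<in> P"
      using x \<F>(2) by blast
    then obtain a where "a \<in> D" "P = g a"
      using g by blast
    then obtain n where n: "a \<in> A n"
      using A(1) by blast
    have "X closure_of (c P) \<subseteq> ?Q n"
      using n \<open>P = g a\<close> unfolding E_def by (intro closure_of_mono) blast
    then show ?thesis
      using c P by blast
  qed
  let ?Y = "subtopology X U"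
  have Y: "subtopology (subtopology X S) U = ?Y"
    using US(1) by (simp add: subtopology_subtopology Int_absorb1)
  have topY: "topspace ?Y = U"
    using US by auto
  \<comment> \<open>Baire's theorem is applied in \<open>U\<close>, an open subset of the closed
    subspace \<open>S\<close>.\<close>
  have "completely_metrizable_space ?Y"
    using completely_metrizable_space_openin
      [OF completely_metrizable_space_closedin[OF X S(1)] U(1)] unfolding Y .
  have small: "wt (subtopology X V) <o |D|" if "V \<subseteq> ?Q n" for V n
  proof -
    let ?Z = "subtopology X (?Q n)"
    have "E n \<subseteq> ?Q n"
      by (rule closure_of_subset[OF E(2)])
    then have "?Z closure_of (E n) = topspace ?Z"
      using closure_of_subset_topspace[of X "E n"]
      unfolding closure_of_subtopology by (simp add: Int_absorb1)
    moreover have "E n \<subseteq> topspace ?Z"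
      using \<open>E n \<subseteq> ?Q n\<close> E(2) by simp
    ultimately have "wt ?Z <o |D|"
      using wt_less_dense[OF metrizable_space_subtopology[OF metr] _ _ D(1) E(1)] by blast
    moreover have "subtopology ?Z V = subtopology X V"
      using \<open>V \<subseteq> ?Q n\<close> by (simp add: subtopology_subtopology Int_absorb1)
    ultimately show ?thesis
      using wt_subtopology_le[of ?Z V] ordLeq_ordLess_trans by metis
  qed
  have "?Y interior_of (\<Union>(range (\<lambda>n. U \<inter> ?Q n))) = {}"
  proof (rule Baire_category_alt)
    show "completely_metrizable_space ?Y \<or> locally_compact_space ?Y \<and> regular_space ?Y"
      using \<open>completely_metrizable_space ?Y\<close> by blast
    fix T assume "T \<in> range (\<lambda>n. U \<inter> ?Q n)"
    then obtain n where T: "T = U \<inter> ?Q n"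
      by blast
    have "closedin ?Y T"
      unfolding T closedin_subtopology by (intro exI[of _ "?Q n"]) auto
    \<comment> \<open>The interior is open in \<open>S\<close>, contained in \<open>U\<close> and of
      weight below \<open>|D|\<close>, so the choice of \<open>U\<close> forces it to be
      empty.\<close>
    moreover have "?Y interior_of T = {}"
    proof (rule ccontr)
      let ?V = "?Y interior_of T"
      assume "?V \<noteq> {}"
      have V: "openin ?Y ?V" "?V \<subseteq> T"
        by (simp_all add: interior_of_subset)
      then have "openin (subtopology X S) ?V"
        using openin_trans_full[of "subtopology X S" U ?V] U(1) Y by simp
      moreover have "?V \<subseteq> U" "?V \<subseteq> ?Q n"
        using V(2) T by auto
      moreover have "subtopology (subtopology X S) ?V = subtopology X ?V"
        using \<open>?V \<subseteq> U\<close> US(1) by (simp add: subtopology_subtopology Int_absorb1)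
      ultimately show False
        using U(3)[of ?V] \<open>?V \<noteq> {}\<close> small[of ?V n] by simp
    qed
    ultimately show "closedin ?Y T \<and> ?Y interior_of T = {}"
      by blast
  qed simp
  moreover have "\<Union>(range (\<lambda>n. U \<inter> ?Q n)) = topspace ?Y"
  proof -
    have "U \<subseteq> (\<Union>n. U \<inter> ?Q n)"
    proof
      fix x assume x: "x \<in> U"
      then have "x \<in> topspace X"
        using US by blast
      then obtain n where "x \<in> ?Q n"
        using cover by blast
      then show "x \<in> (\<Union>n. U \<inter> ?Q n)"
        using x by blast
    qed
    moreover have "(\<Union>n. U \<inter> ?Q n) \<subseteq> U"
      by (rule UN_least) (rule Int_lower1)
    ultimately show ?thesis
      unfolding topY by (rule equalityI[rotated])
  qed
  ultimately show False
    using interior_of_topspace[of ?Y] U(2) topY by simp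
qed

section \<open>Covering and partition numbers\<close>

lemma cov_attained:
  assumes "completely_metrizable_space X"
  obtains \<F> where "\<F> \<subseteq> Polish_subspaces X" "\<Union>\<F> = topspace X" "cov X = |\<F>|"
proof -
  let ?C = "{\<F>. \<F> \<subseteq> Polish_subspaces X \<and> \<Union>\<F> = topspace X}"
  have "(\<lambda>x. {x}) ` topspace X \<in> ?C"
    using singleton_Polish[OF assms] by auto
  then have "?C \<noteq> {}"
    by (metis empty_iff)
  then have "\<exists>\<F>\<in>?C. cov X = |\<F>|"
    unfolding cov_def by (rule least_card_attained)
  then obtain \<F> where "\<F> \<in> ?C" "cov X = |\<F>|"
    by (elim bexE)
  then show thesis
    by (intro that[of \<F>]) simp_all
qed

lemma par_le:
  assumes "Polish_partitionable X \<tau> (topspace X)"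
  shows "par X \<le>o \<tau>"
proof -
  obtain \<F> where \<F>: "\<F> \<subseteq> Polish_subspaces X" "partition_on (topspace X) \<F>" "|\<F>| \<le>o \<tau>"
    using assms unfolding Polish_partitionable_def by blast
  let ?P = "{\<F>. \<F> \<subseteq> Polish_subspaces X \<and> partition_on (topspace X) \<F>}"
  have mem: "\<F> \<in> ?P"
    using \<F>(1,2) by simp
  then have "?P \<noteq> {}"
    by (metis empty_iff)
  then have "par X \<le>o |\<F>|"
    unfolding par_def using mem by (rule least_card_le)
  then show ?thesis
    using \<F>(3) by (rule ordLeq_transitive)
qed

lemma cov_le_par:
  assumes "completely_metrizable_space X"
  shows "cov X \<le>o par X"
proof -
  let ?C = "{\<F>. \<F> \<subseteq> Polish_subspaces X \<and> \<Union>\<F> = topspace X}"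
  let ?P = "{\<F>. \<F> \<subseteq> Polish_subspaces X \<and> partition_on (topspace X) \<F>}"
  have "\<exists>\<F>\<in>?P. par X = |\<F>|"
    unfolding par_def by (rule least_card_attained[OF Polish_partition_exists[OF assms]])
  then obtain \<F> where \<F>: "\<F> \<in> ?P" "par X = |\<F>|"
    by (elim bexE)
  then have mem: "\<F> \<in> ?C"
    using partition_onD1[of "topspace X" \<F>] by simp
  then have "?C \<noteq> {}"
    by (metis empty_iff)
  then have "cov X \<le>o |\<F>|"
    unfolding cov_def using mem by (rule least_card_le)
  then show ?thesis
    by (simp add: \<F>(2))
qed

text \<open>The chain \<open>\<tau> \<le>o cov X\<close>, \<open>cov X \<le>o par X\<close>,
  \<open>par X \<le>o \<tau>\<close> closes up. \<open>\<kappa>\<close> is kept apart from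
  \<open>\<tau>\<close> because it may live on another type.\<close>

lemma cov_par_eqI:
  fixes X :: "'a topology" and \<tau> :: "'b rel" and \<kappa> :: "'k rel"
  assumes "completely_metrizable_space X" "\<tau> =o \<kappa>" "\<tau> \<le>o cov X"
    and "Polish_partitionable X \<tau> (topspace X)"
  shows "cov X =o \<kappa> \<and> par X =o \<kappa>"
proof -
  have par: "par X \<le>o \<tau>"
    by (rule par_le[OF assms(4)])
  have cov: "cov X \<le>o par X"
    by (rule cov_le_par[OF assms(1)])
  have "cov X =o \<tau>"
    unfolding ordIso_iff_ordLeq using ordLeq_transitive[OF cov par] assms(3) by (rule conjI)
  moreover have "par X =o \<tau>"
    unfolding ordIso_iff_ordLeq using par ordLeq_transitive[OF assms(3) cov] by (rule conjI)
  ultimately show ?thesis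
    by (intro conjI ordIso_transitive[OF _ assms(2)])
qed

lemma locally_less_like_cong:
  fixes \<kappa> :: "'b rel" and \<kappa>' :: "'c rel" and Y :: "'d topology"
  assumes "\<kappa> =o \<kappa>'"
  shows "locally_less_like \<kappa> Y \<longleftrightarrow> locally_less_like \<kappa>' Y"
proof -
  have "wt Z <o \<kappa> \<longleftrightarrow> wt Z <o \<kappa>'" for Z :: "'d topology"
    by (rule iffI)
      (erule ordLess_ordIso_trans[OF _ assms], erule ordLess_ordIso_trans[OF _ ordIso_symmetric[OF assms]])
  then show ?thesis
    by (simp add: locally_less_like_def)
qed

text \<open>SCH+ and the weak squares speak of cardinals on the type of points, so the work is done
  with \<open>|D|\<close> for a dense \<open>D\<close> of size \<open>\<kappa>\<close> and carried
  over along \<open>|D| =o \<kappa>\<close>.\<close>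

lemma cov_par_of_weight:
  fixes X :: "'a topology" and \<kappa> :: "'k rel"
  assumes hyps: "SCH_plus TYPE('a)"
      "\<forall>\<mu> :: 'a rel. singular_card \<mu> \<and> cf \<mu> =o natLeq \<longrightarrow> weak_square_omega1 \<mu>"
    and \<kappa>: "Card_order \<kappa>" "natLeq <o \<kappa>" and X: "completely_metrizable_space X" "wt X =o \<kappa>"
  shows "natLeq <o cf \<kappa> \<Longrightarrow> cov X =o \<kappa> \<and> par X =o \<kappa>"
    and "cf \<kappa> =o natLeq \<Longrightarrow> (\<forall>S. closedin X S \<longrightarrow> locally_less_like \<kappa> (subtopology X S)) \<Longrightarrow>
      cov X =o \<kappa> \<and> par X =o \<kappa>"
    and "cf \<kappa> =o natLeq \<Longrightarrow> \<exists>S. closedin X S \<and> \<not> locally_less_like \<kappa> (subtopology X S) \<Longrightarrow>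
      cov X =o cardSuc \<kappa> \<and> par X =o cardSuc \<kappa>"
proof -
  have metr: "metrizable_space X"
    by (rule completely_metrizable_imp_metrizable_space[OF X(1)])
  obtain D where D: "D \<subseteq> topspace X" "X closure_of D = topspace X" "|D| \<le>o wt X"
    by (rule dense_of_wt)
  have wo: "Well_order \<kappa>"
    by (rule card_order_on_well_order_on[OF \<kappa>(1)])
  have "\<not> |D| <o \<kappa>"
  proof
    assume "|D| <o \<kappa>"
    then have "wt X <o \<kappa>"
      by (rule wt_less_dense[OF metr D(1,2) \<kappa>(2)])
    then show False
      using X(2) not_ordLess_ordIso by blast
  qed
  then have "\<kappa> \<le>o |D|"
    using not_ordLess_iff_ordLeq[OF wo card_of_Well_order] by blast
  moreover have "|D| \<le>o \<kappa>"
    by (rule ordLeq_ordIso_trans[OF D(3) X(2)])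
  ultimately have D\<kappa>: "|D| =o \<kappa>"
    by (simp add: ordIso_iff_ordLeq)
  have D_unc: "natLeq <o |D|"
    by (rule ordLess_ordIso_trans[OF \<kappa>(2) ordIso_symmetric[OF D\<kappa>]])
  have infD: "infinite D"
    using D_unc uncountable_iff_natLeq_ordLess countable_finite by blast
  have wtD: "wt X =o |D|"
    by (rule ordIso_transitive[OF X(2) ordIso_symmetric[OF D\<kappa>]])
  note cfD = cf_cong[OF D\<kappa>]
  note main = Polish_partitionable_dense[OF hyps X(1) D(1,2) infD]
  obtain \<F> where \<F>: "\<F> \<subseteq> Polish_subspaces X" "\<Union>\<F> = topspace X" "cov X = |\<F>|"
    by (rule cov_attained[OF X(1)])
  have lower: "|D| \<le>o cov X"
    unfolding \<F>(3)
    by (rule card_Polish_cover_ge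
        [OF metr D_unc ordIso_imp_ordLeq[OF ordIso_symmetric[OF wtD]] \<F>(1,2)])
  {
    assume "natLeq <o cf \<kappa>"
    then have "natLeq <o cf |D|"
      by (rule ordLess_ordIso_trans[OF _ ordIso_symmetric[OF cfD]])
    then show "cov X =o \<kappa> \<and> par X =o \<kappa>"
      by (intro cov_par_eqI[OF X(1) D\<kappa> lower] conjunct2[OF main, rule_format])
  next
    assume "\<forall>S. closedin X S \<longrightarrow> locally_less_like \<kappa> (subtopology X S)"
    then have "\<And>S. closedin X S \<Longrightarrow> locally_less_like |D| (subtopology X S)"
      by (simp add: locally_less_like_cong[OF D\<kappa>])
    then have "Polish_partitionable X |D| (topspace X)"
      by (rule Polish_partitionable_locally_less_like
          [OF hyps X(1) infD ordIso_imp_ordLeq[OF wtD]])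
    then show "cov X =o \<kappa> \<and> par X =o \<kappa>"
      by (rule cov_par_eqI[OF X(1) D\<kappa> lower])
  next
    assume cf: "cf \<kappa> =o natLeq"
      and "\<exists>S. closedin X S \<and> \<not> locally_less_like \<kappa> (subtopology X S)"
    then obtain S where S: "closedin X S" "\<not> locally_less_like |D| (subtopology X S)"
      unfolding locally_less_like_cong[OF D\<kappa>] by (elim exE conjE)
    have "cf |D| =o natLeq"
      by (rule ordIso_transitive[OF cfD cf])
    then have "cardSuc |D| \<le>o cov X"
      unfolding \<F>(3) by (rule card_Polish_cover_ge_cardSuc[OF X(1) D_unc _ S \<F>(1,2)])
    moreover have "cardSuc |D| =o cardSuc \<kappa>"
      using cardSuc_invar_ordIso[OF card_of_Card_order \<kappa>(1)] D\<kappa> by blast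
    ultimately show "cov X =o cardSuc \<kappa> \<and> par X =o cardSuc \<kappa>"
      by (intro cov_par_eqI[OF X(1) _ _ conjunct1[OF main]])
  }
qed

section \<open>Countable weight, and the equality of the two numbers\<close>

lemma par_le_cov_countable_weight:
  assumes X: "completely_metrizable_space X" and "wt X \<le>o natLeq"
  shows "par X \<le>o cov X"
proof -
  obtain D where D: "D \<subseteq> topspace X" "X closure_of D = topspace X" "|D| \<le>o wt X"
    by (rule dense_of_wt)
  have "countable D"
    unfolding countable_iff_ordLeq_natLeq by (rule ordLeq_transitive[OF D(3) assms(2)])
  then have "separable_space X"
    unfolding separable_space_def using D(1,2) by (intro exI[of _ D] conjI)
  then have Polish: "topspace X \<in> Polish_subspaces X"
    using X by (simp add: Polish_subspaces_def Polish_space_def)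
  obtain \<F> where \<F>: "\<Union>\<F> = topspace X" "cov X = |\<F>|"
    by (rule cov_attained[OF X])
  \<comment> \<open>One block, or none for the empty space; a covering of a nonempty space has at
    least one member.\<close>
  let ?\<G> = "{topspace X} - {{}}"
  have "|?\<G>| \<le>o |\<F>|"
  proof (cases "topspace X = {}")
    case True
    then show ?thesis
      by (simp add: card_of_empty)
  next
    case False
    then have "\<F> \<noteq> {}"
      using \<F>(1) by (metis Union_empty)
    then have "|{topspace X}| \<le>o |\<F>|"
      by (rule card_of_singl_ordLeq)
    then show ?thesis
      by (rule ordLeq_transitive[OF card_of_mono1[OF Diff_subset]])
  qed
  moreover have "?\<G> \<subseteq> Polish_subspaces X"
    using Polish by blast
  moreover have "partition_on (topspace X) ?\<G>"
    by (auto simp: partition_on_def disjoint_def)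
  ultimately have "Polish_partitionable X |\<F>| (topspace X)"
    unfolding Polish_partitionable_def by (intro exI[of _ ?\<G>] conjI)
  then show ?thesis
    unfolding \<F>(2) by (rule par_le)
qed

text \<open>Uncountable weight is settled by the three cases with \<open>\<kappa> = wt X\<close>; a
  space of countable weight is Polish itself and is treated apart.\<close>

lemma cov_eq_par:
  fixes X :: "'a topology"
  assumes hyps: "SCH_plus TYPE('a)"
      "\<forall>\<mu> :: 'a rel. singular_card \<mu> \<and> cf \<mu> =o natLeq \<longrightarrow> weak_square_omega1 \<mu>"
    and X: "completely_metrizable_space X"
  shows "cov X =o par X"
proof (cases "wt X \<le>o natLeq")
  case True
  then show ?thesis
    using cov_le_par[OF X] par_le_cov_countable_weight[OF X] by (simp add: ordIso_iff_ordLeq)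
next
  case False
  have card: "Card_order (wt X)"
    by (rule Card_order_wt)
  have wo: "Well_order (wt X)"
    by (rule card_order_on_well_order_on[OF card])
  have unc: "natLeq <o wt X"
    using False not_ordLeq_iff_ordLess[OF natLeq_Well_order wo] by blast
  have refl: "wt X =o wt X"
    by (rule ordIso_reflexive[OF wo])
  have "natLeq \<le>o |Field (wt X)|"
    by (rule ordLeq_ordIso_trans[OF ordLess_imp_ordLeq[OF unc]
          ordIso_symmetric[OF card_of_Field_ordIso[OF card]]])
  then have "infinite (Field (wt X))"
    using infinite_iff_natLeq_ordLeq[of "Field (wt X)"] by blast
  note cases = cf_cases[OF card this]
  note main = cov_par_of_weight[OF hyps card unc X refl]
  have eq: "cov X =o par X" if "cov X =o \<tau> \<and> par X =o \<tau>" for \<tau> :: "'c rel"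
    by (rule ordIso_transitive[OF conjunct1[OF that] ordIso_symmetric[OF conjunct2[OF that]]])
  show ?thesis
  proof (cases rule: cases)
    case 1
    then show ?thesis
      by (rule eq[OF main(1)])
  next
    case 2
    show ?thesis
    proof (cases "\<forall>S. closedin X S \<longrightarrow> locally_less_like (wt X) (subtopology X S)")
      case True
      then show ?thesis
        by (rule eq[OF main(2)[OF 2]])
    next
      case False
      then have "\<exists>S. closedin X S \<and> \<not> locally_less_like (wt X) (subtopology X S)"
        by blast
      then show ?thesis
        by (rule eq[OF main(3)[OF 2]])
    qed
  qed
qed

theorem theorem4p8:
  assumes "SCH_plus TYPE('a)"
    and "\<forall>\<mu> :: 'a rel. singular_card \<mu> \<and> cf \<mu> =o natLeq \<longrightarrow> weak_square_omega1 \<mu>"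
  shows "(\<forall>(\<kappa> :: 'k rel) (X :: 'a topology).
            Card_order \<kappa> \<and> natLeq <o \<kappa> \<and> completely_metrizable_space X \<and> wt X =o \<kappa> \<longrightarrow>
            (natLeq <o cf \<kappa> \<longrightarrow> cov X =o \<kappa> \<and> par X =o \<kappa>) \<and>
            (cf \<kappa> =o natLeq \<longrightarrow>
               (\<forall>S. closedin X S \<longrightarrow> locally_less_like \<kappa> (subtopology X S)) \<and>
                 cov X =o \<kappa> \<and> par X =o \<kappa> \<or>
               (\<exists>S. closedin X S \<and> \<not> locally_less_like \<kappa> (subtopology X S)) \<and>
                 cov X =o cardSuc \<kappa> \<and> par X =o cardSuc \<kappa>)) \<and>
         (\<forall>X :: 'a topology. completely_metrizable_space X \<longrightarrow> cov X =o par X)"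
proof (intro conjI allI impI; (elim conjE)?)
  fix \<kappa> :: "'k rel" and X :: "'a topology"
  assume \<kappa>: "Card_order \<kappa>" "natLeq <o \<kappa>" and X: "completely_metrizable_space X" "wt X =o \<kappa>"
  note main = cov_par_of_weight[OF assms \<kappa> X]
  show "cov X =o \<kappa>" "par X =o \<kappa>" if "natLeq <o cf \<kappa>"
    using main(1)[OF that] by simp_all
  \<comment> \<open>The two alternatives are complementary, so each value is needed only under its
    own condition on closed subspaces.\<close>
  show "(\<forall>S. closedin X S \<longrightarrow> locally_less_like \<kappa> (subtopology X S)) \<and>
      cov X =o \<kappa> \<and> par X =o \<kappa> \<or>
      (\<exists>S. closedin X S \<and> \<not> locally_less_like \<kappa> (subtopology X S)) \<and>
      cov X =o cardSuc \<kappa> \<and> par X =o cardSuc \<kappa>" if "cf \<kappa> =o natLeq"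
    using main(2,3)[OF that] by blast
next
  fix X :: "'a topology"
  assume "completely_metrizable_space X"
  then show "cov X =o par X"
    by (rule cov_eq_par[OF assms])
qed

end
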